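(* The Rado graph $R$ admits no finite dimensional quantum automorphisms which are not classical.
   Context: The Rado graph $R$ is the countable graph whose vertices are the prime numbers congruent to $1$ modulo $4$, with $p,q$ (distinct) connected by an edge iff $p$ is a quadratic residue modulo $q$ (a symmetric relation by quadratic reciprocity). Let $\mathrm{rel}(v,w)\in\{\text{equal},\text{adjacent},\text{distinct and non-adjacent}\}$ denote the adjacency relation of two vertices of a graph $X$ with vertex set $V_X$. A quantum automorphism of $X$ is a pair $(\mathcal H,u)$ of a Hilbert space and a family $u=(u_{xy})_{x,y\in V_X}$ of projections in $B(\mathcal H)$ such that each row and each column consists of pairwise orthogonal projections summing to $1$ in the strong operator topology, and such that $u_{x_1y_1}u_{x_2y_2}=0$ whenever $\mathrm{rel}(x_1,x_2)\neq\mathrm{rel}(y_1,y_2)$. It is finite dimensional if $\mathcal H$ is, and it is called non-classical if the algebra generated by the projections $u_{xy}$, $x,y\in V_X$, is noncommutative (classical otherwise). *)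

theory Defs
  imports "HOL-Analysis.Analysis" "HOL-Number_Theory.Number_Theory"
begin

text \<open>
  The real inner product of \<open>real_inner\<close> is required to be the real part of the complex one, so
  that positive definiteness, the norm and the topology are those of the library class.
  The inner product is conjugate-linear in its first argument.
\<close>

class complex_hilbert_space = real_inner + complete_space +
  fixes scaleC :: "complex \<Rightarrow> 'a \<Rightarrow> 'a"
    and cinner :: "'a \<Rightarrow> 'a \<Rightarrow> complex"
  assumes scaleC_add_right: "scaleC c (x + y) = scaleC c x + scaleC c y"
    and scaleC_add_left: "scaleC (c + d) x = scaleC c x + scaleC d x"
    and scaleC_scaleC: "scaleC c (scaleC d x) = scaleC (c * d) x"
    and scaleC_of_real: "scaleC (complex_of_real r) x = scaleR r x"
    and cinner_commute: "cinner x y = cnj (cinner y x)"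
    and cinner_add_right: "cinner x (y + z) = cinner x y + cinner x z"
    and cinner_scaleC_right: "cinner x (scaleC c y) = c * cinner x y"
    and inner_eq_Re_cinner: "inner x y = Re (cinner x y)"

instantiation complex :: complex_hilbert_space
begin

definition scaleC_complex :: "complex \<Rightarrow> complex \<Rightarrow> complex"
  where "scaleC_complex c x = c * x"

definition cinner_complex :: "complex \<Rightarrow> complex \<Rightarrow> complex"
  where "cinner_complex x y = cnj x * y"

instance
  by standard
    (auto simp: scaleC_complex_def cinner_complex_def algebra_simps inner_complex_def
      scaleR_conv_of_real)

end

instantiation vec :: (complex_hilbert_space, finite) complex_hilbert_space
begin

definition scaleC_vec :: "complex \<Rightarrow> 'a ^ 'b \<Rightarrow> 'a ^ 'b"
  where "scaleC_vec c x = (\<chi> i. scaleC c (x $ i))"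

definition cinner_vec :: "'a ^ 'b \<Rightarrow> 'a ^ 'b \<Rightarrow> complex"
  where "cinner_vec x y = (\<Sum>i\<in>UNIV. cinner (x $ i) (y $ i))"

instance
proof
  show "cinner x y = cnj (cinner y x)" for x y :: "'a ^ 'b"
    unfolding cinner_vec_def cnj_sum by (intro sum.cong refl cinner_commute)
qed (auto simp: scaleC_vec_def cinner_vec_def vec_eq_iff scaleC_add_right scaleC_add_left
      scaleC_scaleC scaleC_of_real cinner_add_right cinner_scaleC_right sum.distrib
      sum_distrib_left inner_vec_def inner_eq_Re_cinner)

end

definition finite_dimensional :: "'h::complex_hilbert_space itself \<Rightarrow> bool"
  where "finite_dimensional _ \<longleftrightarrow>
    (\<exists>B :: 'h set. finite B \<and> Modules.module.span scaleC B = UNIV)"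

lemma vector_space_scaleC:
  "vector_space (scaleC :: complex \<Rightarrow> 'h \<Rightarrow> 'h::complex_hilbert_space)"
  by standard
    (simp_all add: scaleC_add_right scaleC_add_left scaleC_scaleC
      scaleC_of_real [of 1, simplified])

definition bounded_operator :: "('h::complex_hilbert_space \<Rightarrow> 'h) \<Rightarrow> bool"
  where "bounded_operator T \<longleftrightarrow>
    bounded_linear T \<and> (\<forall>c x. T (scaleC c x) = scaleC c (T x))"

definition projection :: "('h::complex_hilbert_space \<Rightarrow> 'h) \<Rightarrow> bool"
  where "projection P \<longleftrightarrow>
    bounded_operator P \<and> P \<circ> P = P \<and> (\<forall>x y. cinner (P x) y = cinner x (P y))"

text \<open>
  Pairwise orthogonal projections with sum 1 in the strong operator topology: for every vector,
  the net of finite partial sums applied to it converges to it.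
\<close>

definition partition_of_unity :: "'v set \<Rightarrow> ('v \<Rightarrow> 'h::complex_hilbert_space \<Rightarrow> 'h) \<Rightarrow> bool"
  where "partition_of_unity V P \<longleftrightarrow>
    (\<forall>x\<in>V. projection (P x)) \<and>
    (\<forall>x\<in>V. \<forall>y\<in>V. x \<noteq> y \<longrightarrow> P x \<circ> P y = (\<lambda>_. 0)) \<and>
    (\<forall>\<xi>. ((\<lambda>x. P x \<xi>) has_sum \<xi>) V)"

inductive_set generated_algebra ::
  "('h::complex_hilbert_space \<Rightarrow> 'h) set \<Rightarrow> ('h \<Rightarrow> 'h) set"
  for G :: "('h \<Rightarrow> 'h) set"
  where
    generator: "T \<in> G \<Longrightarrow> T \<in> generated_algebra G"
  | zero: "(\<lambda>_. 0) \<in> generated_algebra G"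
  | add: "S \<in> generated_algebra G \<Longrightarrow> T \<in> generated_algebra G \<Longrightarrow>
      (\<lambda>\<xi>. S \<xi> + T \<xi>) \<in> generated_algebra G"
  | scale: "T \<in> generated_algebra G \<Longrightarrow> (\<lambda>\<xi>. scaleC c (T \<xi>)) \<in> generated_algebra G"
  | mult: "S \<in> generated_algebra G \<Longrightarrow> T \<in> generated_algebra G \<Longrightarrow>
      S \<circ> T \<in> generated_algebra G"

datatype relation_type = Equal | Adjacent | Nonadjacent

definition rel :: "('v \<Rightarrow> 'v \<Rightarrow> bool) \<Rightarrow> 'v \<Rightarrow> 'v \<Rightarrow> relation_type"
  where "rel adj v w = (if v = w then Equal else if adj v w then Adjacent else Nonadjacent)"

text \<open>
  A graph is given by its vertex set \<open>V\<close> and its adjacency relation \<open>adj\<close>. The values of \<open>adj\<close>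
  and \<open>u\<close> outside \<open>V\<close> are irrelevant. The Hilbert space is the type \<open>'h\<close>.
\<close>

definition quantum_automorphism ::
  "'v set \<Rightarrow> ('v \<Rightarrow> 'v \<Rightarrow> bool) \<Rightarrow> ('v \<Rightarrow> 'v \<Rightarrow> 'h::complex_hilbert_space \<Rightarrow> 'h) \<Rightarrow> bool"
  where "quantum_automorphism V adj u \<longleftrightarrow>
    (\<forall>x\<in>V. partition_of_unity V (\<lambda>y. u x y)) \<and>
    (\<forall>y\<in>V. partition_of_unity V (\<lambda>x. u x y)) \<and>
    (\<forall>x1\<in>V. \<forall>y1\<in>V. \<forall>x2\<in>V. \<forall>y2\<in>V.
      rel adj x1 x2 \<noteq> rel adj y1 y2 \<longrightarrow> u x1 y1 \<circ> u x2 y2 = (\<lambda>_. 0))"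

definition classical :: "'v set \<Rightarrow> ('v \<Rightarrow> 'v \<Rightarrow> 'h::complex_hilbert_space \<Rightarrow> 'h) \<Rightarrow> bool"
  where "classical V u \<longleftrightarrow>
    (\<forall>S \<in> generated_algebra {u x y | x y. x \<in> V \<and> y \<in> V}.
     \<forall>T \<in> generated_algebra {u x y | x y. x \<in> V \<and> y \<in> V}. S \<circ> T = T \<circ> S)"

definition rado_vertices :: "nat set"
  where "rado_vertices = {p. prime p \<and> [p = 1] (mod 4)}"

text \<open>\<open>QuadRes q p\<close> says that \<open>p\<close> is a square modulo \<open>q\<close> (modulus first).\<close>

definition rado_adj :: "nat \<Rightarrow> nat \<Rightarrow> bool"
  where "rado_adj p q \<longleftrightarrow> p \<noteq> q \<and> QuadRes (int q) (int p)"

lemma rado_adj_sym: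
  assumes "p \<in> rado_vertices" "q \<in> rado_vertices"
  shows "rado_adj p q \<longleftrightarrow> rado_adj q p"
proof (cases "p = q")
  case False
  have p: "prime p" "p mod 4 = 1" and q: "prime q" "q mod 4 = 1"
    using assms by (auto simp: rado_vertices_def cong_def)
  have "p \<noteq> 2" "q \<noteq> 2" using p q by auto
  then have "2 < p" "2 < q"
    using prime_ge_2_nat [OF p(1)] prime_ge_2_nat [OF q(1)] by auto
  moreover have "even ((p - 1) div 2)" using p(2) by presburger
  ultimately have "Legendre (int p) (int q) * Legendre (int q) (int p) = 1"
    using Quadratic_Reciprocity [of p q] p q False by simp
  then show ?thesis
    using False by (auto simp: rado_adj_def Legendre_def split: if_splits)
qed (simp add: rado_adj_def)

end

theory Submission
  imports Defs
begin

text \<open>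
  Two entries \<open>u x1 y1\<close> and \<open>u x2 y2\<close> with \<open>x1 \<noteq> x2\<close>, \<open>y1 \<noteq> y2\<close> have to commute. In finite
  dimension, each row of \<open>u\<close> has only finitely many nonzero entries; let \<open>Y\<close> be a finite set
  containing \<open>y1\<close>, \<open>y2\<close> and the columns of all nonzero entries of the rows \<open>x1\<close> and \<open>x2\<close>. If \<open>z\<close>
  is a vertex outside \<open>Y\<close> whose neighbours in \<open>Y\<close> are exactly \<open>y1\<close> and \<open>y2\<close>, then
  \<open>u xi y1 + u xi y2\<close> acts on the range of \<open>u x z\<close> as \<open>1\<close> or \<open>0\<close>, according to whether \<open>xi\<close> and
  \<open>x\<close> are adjacent. As the ranges of the \<open>u x z\<close> span the whole space, \<open>u x1 y1 + u x1 y2\<close> and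
  \<open>u x2 y1 + u x2 y2\<close> commute. Multiplying this relation by \<open>u x1 y1\<close> on the left, respectively on
  the right, yields \<open>u x1 y1 \<circ> u x2 y2 = u x1 y1 \<circ> u x2 y2 \<circ> u x1 y1 = u x2 y2 \<circ> u x1 y1\<close>.

  The vertex \<open>z\<close> is a prime with prescribed quadratic characters modulo \<open>4\<close> and modulo finitely many
  odd primes. Its existence is the quadratic part of Dirichlet's theorem, which only involves real
  characters \<open>\<phi>\<close>: the sums of \<open>\<phi> n * mangoldt n / n\<close> are bounded for nonprincipal \<open>\<phi>\<close>, because
  \<open>L(1, \<phi>) \<noteq> 0\<close>, and unbounded for the principal character.
\<close>

section \<open>Divisor sums and the Chebyshev function\<close>

text \<open>Both sides run over the pairs \<open>(d, m)\<close> with \<open>d * m \<le> N\<close>: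
  the left groups them by the product, the right by the first factor.\<close>

lemma sum_divisor_pairs:
  fixes g :: "nat \<Rightarrow> nat \<Rightarrow> 'a::comm_monoid_add"
  shows "(\<Sum>n\<in>{1..N}. \<Sum>d | d dvd n. g d (n div d)) = (\<Sum>d\<in>{1..N}. \<Sum>m\<in>{1..N div d}. g d m)"
proof -
  have le: "d \<le> N" if "d * m \<le> N" "0 < m" for d m
    using that by (cases m) auto
  have "(\<Sum>n\<in>{1..N}. \<Sum>d | d dvd n. g d (n div d))
      = (\<Sum>(n, d)\<in>(SIGMA n:{1..N}. {d. d dvd n}). g d (n div d))"
    by (subst sum.Sigma) (auto simp: split_beta)
  also have "\<dots> = (\<Sum>(d, m)\<in>(SIGMA d:{1..N}. {1..N div d}). g d m)"
    by (rule sum.reindex_bij_witness [where i = "\<lambda>(d, m). (d * m, d)" and j = "\<lambda>(n, d). (d, n div d)"])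
       (auto simp: less_eq_div_iff_mult_less_eq mult.commute Suc_le_eq
         intro: div_le_mono le dest: dvd_imp_le intro!: Nat.gr0I elim!: dvdE)
  also have "\<dots> = (\<Sum>d\<in>{1..N}. \<Sum>m\<in>{1..N div d}. g d m)"
    by (subst sum.Sigma) (auto simp: split_beta)
  finally show ?thesis .
qed

text \<open>Abel summation. The induction compares the sum with the partial sum of \<open>a\<close>
  times \<open>b N\<close>; each step costs at most \<open>B * (b n - b (Suc n))\<close>, which
  telescopes.\<close>

lemma abel_sum_bound:
  fixes a b :: "nat \<Rightarrow> real"
  assumes partial: "\<And>j. m \<le> j \<Longrightarrow> \<bar>\<Sum>k=m..j. a k\<bar> \<le> B"
    and dec: "\<And>k. m \<le> k \<Longrightarrow> b (Suc k) \<le> b k"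
    and nonneg: "\<And>k. m \<le> k \<Longrightarrow> 0 \<le> b k"
  shows "\<bar>\<Sum>k=m..N. a k * b k\<bar> \<le> B * b m"
proof -
  have B: "0 \<le> B"
    using partial [of m] by simp
  show ?thesis
  proof (cases "m \<le> N")
    case True
    then have "\<bar>(\<Sum>k=m..N. a k * b k) - (\<Sum>k=m..N. a k) * b N\<bar> \<le> B * (b m - b N)"
    proof (induction rule: dec_induct)
      case (step n)
      have "\<bar>(\<Sum>k=m..n. a k) * (b n - b (Suc n))\<bar> \<le> B * (b n - b (Suc n))"
        unfolding abs_mult using partial [of n] dec [of n] step.hyps
        by (intro mult_mono) auto
      moreover have "(\<Sum>k=m..Suc n. a k * b k) - (\<Sum>k=m..Suc n. a k) * b (Suc n)
          = ((\<Sum>k=m..n. a k * b k) - (\<Sum>k=m..n. a k) * b n) + (\<Sum>k=m..n. a k) * (b n - b (Suc n))"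
        using step.hyps by (simp add: algebra_simps)
      ultimately show ?case
        using step.IH by (simp add: algebra_simps)
    qed auto
    moreover have "\<bar>(\<Sum>k=m..N. a k) * b N\<bar> \<le> B * b N"
      unfolding abs_mult using partial [of N] nonneg [of N] True B
      by (intro mult_mono) auto
    ultimately show ?thesis
      by (simp add: algebra_simps)
  qed (use B nonneg [of m] in simp)
qed

definition chebyshev_psi :: "nat \<Rightarrow> real"
  where "chebyshev_psi N = (\<Sum>d\<in>{1..N}. mangoldt d)"

lemma sum_ln_eq_mangoldt: "(\<Sum>n\<in>{1..N}. ln (real n)) = (\<Sum>d\<in>{1..N}. mangoldt d * real (N div d))"
proof -
  have "(\<Sum>n\<in>{1..N}. ln (real n)) = (\<Sum>n\<in>{1..N}. \<Sum>d | d dvd n. mangoldt d)"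
    by (intro sum.cong) (auto simp: mangoldt_sum)
  also have "\<dots> = (\<Sum>d\<in>{1..N}. \<Sum>m\<in>{1..N div d}. mangoldt d)"
    by (rule sum_divisor_pairs)
  finally show ?thesis by (simp add: mult.commute)
qed

text \<open>\<open>mangoldt d\<close> enters the logarithm of \<open>(2 * m) choose m\<close> with
  weight \<open>(2 * m) div d - 2 * (m div d)\<close>. This weight is never negative and equals 1
  for \<open>m < d \<le> 2 * m\<close>, and the binomial coefficient is at most
  \<open>4 ^ m\<close>.\<close>

lemma chebyshev_psi_double_le: "chebyshev_psi (2 * m) - chebyshev_psi m \<le> real m * ln 4"
proof -
  let ?f = "\<lambda>d. mangoldt d * (real ((2 * m) div d) - 2 * real (m div d)) :: real"
  have nn: "0 \<le> ?f d" for d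
  proof -
    have "2 * (m div d) \<le> (2 * m) div d"
      by (cases "d = 0") (auto simp: less_eq_div_iff_mult_less_eq mult.assoc)
    then have "real (2 * (m div d)) \<le> real ((2 * m) div d)"
      by (rule of_nat_mono)
    then show ?thesis
      using mangoldt_nonneg [of d] by (intro mult_nonneg_nonneg) auto
  qed
  have fact_sum: "(\<Sum>n\<in>{1..N}. ln (real n)) = ln (fact N)" for N
    by (induction N) (auto simp: ln_mult add_ac)
  have "chebyshev_psi (2 * m) - chebyshev_psi m = (\<Sum>d\<in>{Suc m..2 * m}. mangoldt d)"
  proof -
    have "{1..2 * m} = {1..m} \<union> {Suc m..2 * m}" by auto
    then show ?thesis
      unfolding chebyshev_psi_def by (simp add: sum.union_disjoint)
  qed
  also have "\<dots> \<le> (\<Sum>d\<in>{Suc m..2 * m}. ?f d)"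
  proof (intro sum_mono)
    fix d assume d: "d \<in> {Suc m..2 * m}"
    then have "(2 * m) div d = 1" "m div d = 0"
      by (auto intro!: div_nat_eqI)
    then show "mangoldt d \<le> ?f d" by simp
  qed
  also have "\<dots> \<le> (\<Sum>d\<in>{1..2 * m}. ?f d)"
    using nn by (intro sum_mono2) auto
  also have "\<dots> = (\<Sum>d\<in>{1..2 * m}. mangoldt d * real ((2 * m) div d))
      - 2 * (\<Sum>d\<in>{1..2 * m}. mangoldt d * real (m div d))"
    by (simp add: sum_distrib_left sum_subtractf algebra_simps)
  also have "(\<Sum>d\<in>{1..2 * m}. mangoldt d * real (m div d) :: real) = (\<Sum>d\<in>{1..m}. mangoldt d * real (m div d))"
    by (intro sum.mono_neutral_right) auto
  also have "(\<Sum>d\<in>{1..2 * m}. mangoldt d * real ((2 * m) div d)) - 2 * \<dots> = ln (fact (2 * m)) - 2 * ln (fact m)"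
    by (simp only: sum_ln_eq_mangoldt [symmetric] fact_sum)
  also have "\<dots> = ln (real ((2 * m) choose m))"
    by (simp add: binomial_fact ln_div ln_mult)
  also have "\<dots> \<le> ln (4 ^ m)"
  proof -
    have "(2 * m) choose m \<le> 2 ^ (2 * m)"
      by (rule binomial_le_pow2)
    then have "real ((2 * m) choose m) \<le> real (2 ^ (2 * m))"
      by (rule of_nat_mono)
    then show ?thesis
      by (subst ln_le_cancel_iff) (auto simp: power_mult)
  qed
  finally show ?thesis by (simp add: ln_realpow)
qed

text \<open>Strong induction through \<open>m = N div 2\<close>. Doubling turns the bound for
  \<open>m\<close> into \<open>5 * ln 4 * m\<close>; a possible odd last term costs at most another
  \<open>2 * ln 4 * m\<close>, and the target is at least \<open>8 * ln 4 * m\<close>.\<close>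

lemma chebyshev_psi_le: "chebyshev_psi N \<le> 4 * ln 4 * real N"
proof (induction N rule: less_induct)
  case (less N)
  show ?case
  proof (cases "N \<le> 1")
    case True
    then show ?thesis by (cases N) (auto simp: chebyshev_psi_def)
  next
    case False
    define m where "m = N div 2"
    have m: "0 < m" "m < N" "2 * m \<le> N" "N \<le> 2 * m + 1" "N < 4 * m"
      using False unfolding m_def by presburger+
    have "chebyshev_psi N \<le> chebyshev_psi (2 * m) + ln (real N)"
    proof (cases "N = 2 * m")
      case False
      with m have N: "N = Suc (2 * m)" by simp
      show ?thesis
        using mangoldt_le [of N] unfolding N chebyshev_psi_def by simp
    qed (use m in simp)
    also have "ln (real N) \<le> ln (4 * real m)"
      using m by (subst ln_le_cancel_iff) auto
    also have "ln (4 * real m) = ln 4 + ln (real m)"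
      using m by (simp add: ln_mult)
    also have "ln (real m) \<le> real m - 1"
      using m ln_le_minus_one [of "real m"] by simp
    also have "chebyshev_psi (2 * m) \<le> chebyshev_psi m + real m * ln 4"
      using chebyshev_psi_double_le [of m] by simp
    also have "chebyshev_psi m \<le> 4 * ln 4 * real m"
      using less.IH m by simp
    finally have *: "chebyshev_psi N \<le> 5 * ln 4 * real m + ln 4 + (real m - 1)"
      by (simp add: algebra_simps)
    have ln4: "1 \<le> ln (4::real)"
      using exp_le ln_ge_iff [of 4 1] by simp
    then have "real m - 1 \<le> ln 4 * (real m - 1)" "ln 4 \<le> ln 4 * real m"
      using m by (auto simp: mult_le_cancel_right1)
    with * have "chebyshev_psi N \<le> 7 * ln 4 * real m" using ln4 by (simp add: algebra_simps)
    also have "\<dots> \<le> 8 * ln 4 * real m" using ln4 m by simp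
    also have "\<dots> \<le> 4 * ln 4 * real N" using m ln4 by simp
    finally show ?thesis .
  qed
qed

section \<open>Real characters\<close>

text \<open>Real Dirichlet characters, with \<open>q\<close> any period. Principal ones are
  included, so that divergence and boundedness of the prime sums concern the same kind of
  object.\<close>

locale real_character =
  fixes \<phi> :: "nat \<Rightarrow> real" and q :: nat
  assumes period_pos: "0 < q"
    and mult: "\<phi> (m * n) = \<phi> m * \<phi> n"
    and one: "\<phi> (Suc 0) = 1"
    and range: "\<phi> n \<in> {-1, 0, 1}"
    and periodic: "\<phi> (n mod q) = \<phi> n"
begin

lemma power: "\<phi> (n ^ k) = \<phi> n ^ k"
  by (induction k) (auto simp: mult one)

lemma abs_le_1: "\<bar>\<phi> n\<bar> \<le> 1"
  using range [of n] by auto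

text \<open>The Dirichlet convolution of \<open>\<phi>\<close> with 1: the coefficients of
  \<open>zeta(s) * L(s, \<phi>)\<close>.\<close>

definition divisor_sum :: "nat \<Rightarrow> real"
  where "divisor_sum n = (\<Sum>d | d dvd n. \<phi> d)"

text \<open>Each divisor of \<open>p ^ k * m\<close> is \<open>p ^ i * d\<close> for exactly one
  pair, with \<open>i\<close> its multiplicity at \<open>p\<close>. The sign estimates below split
  off one prime at a time in this way.\<close>

lemma divisor_sum_prime_power_mult:
  assumes p: "prime p" and m: "\<not> p dvd m"
  shows "divisor_sum (p ^ k * m) = (\<Sum>i\<le>k. \<phi> p ^ i) * divisor_sum m"
proof -
  have m0: "0 < m" using m by (cases m) auto
  have not_dvd: "\<not> p dvd d" if "d dvd m" for d
    using that m dvd_trans by blast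
  have mult_p: "multiplicity p (p ^ i * d) = i" if "d dvd m" for i d
    using not_dvd [OF that] that m0 p
    by (subst prime_elem_multiplicity_mult_distrib)
       (auto simp: not_dvd_imp_multiplicity_0 multiplicity_prime_power intro!: Nat.gr0I)
  have inj: "inj_on (\<lambda>(i, d). p ^ i * d) ({..k} \<times> {d. d dvd m})"
  proof (rule inj_onI, clarify)
    fix i d j e
    assume d: "d dvd m" and e: "e dvd m" and eq: "p ^ i * d = p ^ j * e"
    have "i = j"
      using mult_p [OF d, of i] mult_p [OF e, of j] eq by simp
    then show "i = j \<and> d = e"
      using eq p by (auto simp: prime_gt_0_nat)
  qed
  have img: "(\<lambda>(i, d). p ^ i * d) ` ({..k} \<times> {d. d dvd m}) = {d. d dvd p ^ k * m}"
  proof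
    show "(\<lambda>(i, d). p ^ i * d) ` ({..k} \<times> {d. d dvd m}) \<subseteq> {d. d dvd p ^ k * m}"
      by (auto intro!: mult_dvd_mono le_imp_power_dvd)
    show "{d. d dvd p ^ k * m} \<subseteq> (\<lambda>(i, d). p ^ i * d) ` ({..k} \<times> {d. d dvd m})"
    proof
      fix x assume "x \<in> {d. d dvd p ^ k * m}"
      then have "x dvd p ^ k * m" by simp
      then obtain b c where x: "x = b * c" "b dvd p ^ k" "c dvd m"
        using division_decomp by blast
      then obtain i where "i \<le> k" "b = p ^ i"
        using p divides_primepow_nat by blast
      with x show "x \<in> (\<lambda>(i, d). p ^ i * d) ` ({..k} \<times> {d. d dvd m})"
        by (intro image_eqI [of _ _ "(i, c)"]) auto
    qed
  qed
  have "divisor_sum (p ^ k * m) = (\<Sum>(i, d)\<in>{..k} \<times> {d. d dvd m}. \<phi> (p ^ i * d))"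
    unfolding divisor_sum_def img [symmetric] by (subst sum.reindex [OF inj]) (simp add: split_beta)
  also have "\<dots> = (\<Sum>i\<le>k. \<Sum>d | d dvd m. \<phi> p ^ i * \<phi> d)"
    by (subst sum.cartesian_product) (simp add: mult power split_beta)
  finally show ?thesis
    by (simp add: divisor_sum_def sum_product)
qed

lemma sum_powers_nonneg: "0 \<le> (\<Sum>i\<le>k. \<phi> p ^ i)"
proof -
  have "(\<Sum>i\<le>k. (-1) ^ i :: real) = (if even k then 1 else 0)"
    by (induction k) auto
  moreover have "0 \<le> (\<Sum>i\<le>k. \<phi> p ^ i)" if "0 \<le> \<phi> p"
    using that by (intro sum_nonneg) auto
  ultimately show ?thesis using range [of p] by auto
qed

lemma sum_even_powers_ge_1: "1 \<le> (\<Sum>i\<le>2 * k. \<phi> p ^ i)"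
proof -
  have "(\<Sum>i\<le>n. (-1) ^ i :: real) = (if even n then 1 else 0)" for n
    by (induction n) auto
  then have "(\<Sum>i\<le>2 * k. (-1) ^ i :: real) = 1"
    by simp
  \<comment> \<open>The exponent 0 contributes 1, since \<open>0 ^ 0 = 1\<close>.\<close>
  moreover have "(\<Sum>i\<le>2 * k. 0 ^ i :: real) = 1"
    by (simp add: power_0_left)
  ultimately show ?thesis using range [of p] by auto
qed

lemma divisor_sum_nonneg: "0 < n \<Longrightarrow> 0 \<le> divisor_sum n"
proof (induction n rule: less_induct)
  case (less n)
  show ?case
  proof (cases "n = 1")
    case True
    then show ?thesis by (simp add: divisor_sum_def one)
  next
    case False
    then obtain p where p: "prime p" "p dvd n"
      using prime_factor_nat by blast
    then obtain m where m: "n = p ^ multiplicity p n * m" "\<not> p dvd m"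
      using multiplicity_decompose' [of n p] less.prems by (metis not_prime_unit less_numeral_extra(3))
    have "0 < m" using m(1) less.prems by (intro Nat.gr0I) auto
    have "m \<noteq> n" using m(2) p(2) by auto
    moreover have "m \<le> n" using m(1) less.prems dvd_imp_le by (metis dvd_triv_right)
    ultimately have "0 \<le> divisor_sum m" using less.IH \<open>0 < m\<close> by simp
    then show ?thesis
      using divisor_sum_prime_power_mult [OF p(1) m(2), of "multiplicity p n"] m(1) sum_powers_nonneg
      by simp
  qed
qed

text \<open>Every prime occurs in a square with even multiplicity, where its factor is at least 1
  even if \<open>\<phi> p = -1\<close>. These values make the power series of
  \<open>divisor_sum\<close> unbounded near 1.\<close>

lemma divisor_sum_square: "0 < n \<Longrightarrow> 1 \<le> divisor_sum (n\<^sup>2)"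
proof (induction n rule: less_induct)
  case (less n)
  show ?case
  proof (cases "n = 1")
    case True
    then show ?thesis by (simp add: divisor_sum_def one)
  next
    case False
    then obtain p where p: "prime p" "p dvd n"
      using prime_factor_nat by blast
    define k where "k = multiplicity p n"
    obtain m where m: "n = p ^ k * m" "\<not> p dvd m"
      using multiplicity_decompose' [of n p] less.prems p unfolding k_def
      by (metis not_prime_unit less_numeral_extra(3))
    have "0 < m" using m(1) less.prems by (intro Nat.gr0I) auto
    have "m \<noteq> n" using m(2) p(2) by auto
    moreover have "m \<le> n" using m(1) less.prems dvd_imp_le by (metis dvd_triv_right)
    ultimately have "1 \<le> divisor_sum (m\<^sup>2)" using less.IH \<open>0 < m\<close> by simp
    moreover have "\<not> p dvd m\<^sup>2" using m p by (auto dest: prime_dvd_power)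
    moreover have "n\<^sup>2 = p ^ (2 * k) * m\<^sup>2"
      by (simp add: m(1) power_mult_distrib power_mult [symmetric] mult.commute)
    ultimately show ?thesis
      using divisor_sum_prime_power_mult [OF p(1), of "m\<^sup>2" "2 * k"] sum_even_powers_ge_1 [of p k]
        mult_mono [of 1 "\<Sum>i\<le>2 * k. \<phi> p ^ i" 1 "divisor_sum (m\<^sup>2)"]
      by simp
  qed
qed

end

text \<open>AM-GM for \<open>s ^ (2 * i)\<close> with \<open>i < n\<close>, whose geometric mean is
  \<open>s ^ (n - 1)\<close>. Bernoulli's inequality gives the induction step.\<close>

lemma geometric_am_gm:
  fixes s :: real
  assumes "0 < s" "s < 1"
  shows "real n * s ^ n \<le> s * (\<Sum>i<n. (s\<^sup>2) ^ i)"
proof (induction n)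
  case (Suc n)
  have "1 - s ^ n \<le> real n * (1 - s)"
    using Bernoulli_inequality [of "s - 1" n] assms by (simp add: algebra_simps)
  then have "s ^ n * (s * (1 - s ^ n)) \<le> s ^ n * (1 * (real n * (1 - s)))"
    using assms by (intro mult_left_mono mult_mono) (auto simp: power_le_one)
  then have "real (Suc n) * s ^ Suc n \<le> real n * s ^ n + s * (s ^ n * s ^ n)"
    by (simp add: algebra_simps)
  also have "s ^ n * s ^ n = (s\<^sup>2) ^ n"
    by (simp add: power_mult_distrib power2_eq_square)
  finally show ?case using Suc by (simp add: algebra_simps)
qed simp

text \<open>
  Monsky's proof of \<open>L(1, \<phi>) \<noteq> 0\<close>: the Lambert series of \<open>\<phi>\<close> is the power series of \<open>divisor_sum\<close>,
  which is unbounded as \<open>t\<close> tends to \<open>1\<close>. These decreasing weights are what remains of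
  \<open>t ^ n / (1 - t ^ n)\<close> after the subtraction of its main term, which contributes
  \<open>L(1, \<phi>) / (1 - t)\<close>.
\<close>

definition lambert_weight :: "real \<Rightarrow> nat \<Rightarrow> real"
  where "lambert_weight t n = 1 / (real n * (1 - t)) - t ^ n / (1 - t ^ n)"

lemma lambert_weight_1: "0 < t \<Longrightarrow> t < 1 \<Longrightarrow> lambert_weight t 1 = 1"
  by (simp add: lambert_weight_def diff_divide_distrib [symmetric])

lemma lambert_weight_altdef:
  assumes t: "0 < t" "t < 1" and n: "1 \<le> n"
  shows "lambert_weight t n = (1 / real n - t ^ n / (\<Sum>i<n. t ^ i)) / (1 - t)"
proof -
  have "1 - t ^ n = (1 - t) * (\<Sum>i<n. t ^ i)"
    by (rule one_diff_power_eq)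
  then show ?thesis
    using t n by (simp add: lambert_weight_def diff_divide_distrib mult.commute)
qed

lemma lambert_weight_nonneg:
  assumes t: "0 < t" "t < 1" and n: "1 \<le> n"
  shows "0 \<le> lambert_weight t n"
proof -
  have "(\<Sum>i<n. t ^ n) \<le> (\<Sum>i<n. t ^ i)"
    using t by (intro sum_mono power_decreasing) auto
  then have le: "real n * t ^ n \<le> (\<Sum>i<n. t ^ i)"
    by simp
  moreover have "0 < real n * t ^ n" using t n by simp
  ultimately have "0 < (\<Sum>i<n. t ^ i)" by linarith
  then have "t ^ n / (\<Sum>i<n. t ^ i) \<le> 1 / real n"
    using le n by (simp add: field_simps)
  then show ?thesis
    unfolding lambert_weight_altdef [OF assms] using t by simp
qed

text \<open>Times \<open>1 - t\<close>, the drop between consecutive weights is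
  \<open>1 / (n * (n + 1)) - t ^ n / (g * h)\<close>, where \<open>g\<close> and \<open>h\<close>
  are geometric sums of lengths \<open>n\<close> and \<open>n + 1\<close>. Two instances of AM-GM at
  \<open>s = sqrt t\<close> bound \<open>n * (n + 1) * t ^ n\<close> by
  \<open>g * h\<close>.\<close>

lemma lambert_weight_decreasing:
  assumes t: "0 < t" "t < 1" and n: "1 \<le> n"
  shows "lambert_weight t (Suc n) \<le> lambert_weight t n"
proof -
  define g where "g = (\<Sum>i<n. t ^ i)"
  define h where "h = (\<Sum>i<Suc n. t ^ i)"
  have h_eq: "h = 1 + t * g"
    unfolding g_def h_def by (subst sum.lessThan_Suc_shift) (simp add: sum_distrib_left)
  have g: "0 < g"
    unfolding g_def using t n by (intro sum_pos) (auto simp: lessThan_empty_iff)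
  have h: "0 < h"
    unfolding h_eq using g t by (simp add: add_pos_pos)
  define s where "s = sqrt t"
  have s: "0 < s" "s < 1" "s\<^sup>2 = t" using t by (auto simp: s_def)
  have "(real n * s ^ n) * (real (Suc n) * s ^ Suc n) \<le> (s * g) * (s * h)"
  proof (rule mult_mono)
    show "real n * s ^ n \<le> s * g" "real (Suc n) * s ^ Suc n \<le> s * h"
      using geometric_am_gm [OF s(1,2)] unfolding g_def h_def s(3) by blast+
  qed (use s g in auto)
  also have "(s * g) * (s * h) = t * (g * h)"
    using s(3) by (simp add: power2_eq_square)
  finally have 1: "(real n * s ^ n) * (real (Suc n) * s ^ Suc n) \<le> t * (g * h)" .
  \<comment> \<open>A factor \<open>s < 1\<close> is left over here and is discarded.\<close>
  have "t * (real n * real (Suc n) * t ^ n) = s * ((real n * s ^ n) * (real (Suc n) * s ^ Suc n))"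
    unfolding s(3) [symmetric] by (simp add: power2_eq_square power_mult_distrib)
  also have "\<dots> \<le> (real n * s ^ n) * (real (Suc n) * s ^ Suc n)"
    using s by (intro mult_left_le_one_le) auto
  finally have "real n * real (Suc n) * t ^ n \<le> g * h"
    using 1 t by (meson mult_le_cancel_left_pos order.trans)
  moreover have "x / y \<le> 1 / c" if "c * x \<le> y" "0 < c" "0 < y" for c x y :: real
    using that by (simp add: field_simps)
  ultimately have "t ^ n / (g * h) \<le> 1 / (real n * real (Suc n))"
    using g h n by simp
  moreover have "t ^ n / g - t ^ Suc n / h = t ^ n / (g * h)"
    using g h by (simp add: field_simps h_eq)
  moreover have "1 / real n - 1 / real (Suc n) = 1 / (real n * real (Suc n))"
    using n by (simp add: field_simps)
  ultimately have "1 / real (Suc n) - t ^ Suc n / h \<le> 1 / real n - t ^ n / g"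
    by linarith
  then show ?thesis
    using t n by (simp only: lambert_weight_altdef g_def h_def divide_right_mono)
qed

section \<open>Nonprincipal characters and the nonvanishing of \<open>L(1, \<phi>)\<close>\<close>

locale nonprincipal_real_character = real_character +
  assumes nonprincipal: "\<exists>a. coprime a q \<and> \<phi> a = -1"
begin

text \<open>Multiplication by \<open>a\<close> permutes the residues modulo \<open>q\<close> and
  reverses the sign of the sum.\<close>

lemma sum_period: "(\<Sum>k<q. \<phi> k) = 0"
proof -
  obtain a where a: "coprime a q" "\<phi> a = -1"
    using nonprincipal by blast
  have inj: "inj_on (\<lambda>k. a * k mod q) {..<q}"
  proof (rule inj_onI)
    fix x y assume "x \<in> {..<q}" "y \<in> {..<q}" "a * x mod q = a * y mod q"
    then show "x = y"
      using cong_mult_lcancel_nat [OF a(1), of x y] by (simp add: cong_def)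
  qed
  moreover have "(\<lambda>k. a * k mod q) ` {..<q} \<subseteq> {..<q}"
    using period_pos by auto
  ultimately have img: "(\<lambda>k. a * k mod q) ` {..<q} = {..<q}"
    by (intro endo_inj_surj) auto
  have "(\<Sum>k<q. \<phi> k) = (\<Sum>k<q. \<phi> (a * k mod q))"
    using sum.reindex [OF inj, of \<phi>] unfolding img by simp
  also have "\<dots> = - (\<Sum>k<q. \<phi> k)"
    by (simp add: periodic mult a sum_negf)
  finally show ?thesis by simp
qed

lemma sum_lessThan_bound: "\<bar>\<Sum>k<N. \<phi> k\<bar> \<le> real q"
proof (induction N rule: less_induct)
  case (less N)
  have shift: "(\<Sum>k<M + q. \<phi> k) = (\<Sum>k<M. \<phi> k)" for M
  proof (induction M)
    case (Suc M)
    have "\<phi> (M + q) = \<phi> M"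
      using periodic [of "M + q"] periodic [of M] by simp
    with Suc show ?case by simp
  qed (simp add: sum_period)
  show ?case
  proof (cases "N < q")
    case True
    have "\<bar>\<Sum>k<N. \<phi> k\<bar> \<le> (\<Sum>k<N. 1)"
      by (rule order.trans [OF sum_abs]) (intro sum_mono abs_le_1)
    then show ?thesis using True by simp
  next
    case False
    then have "N = (N - q) + q" by simp
    then show ?thesis
      using shift [of "N - q"] less.IH [of "N - q"] False period_pos by simp
  qed
qed

lemma sum_interval_bound: "\<bar>\<Sum>k=m..j. \<phi> k\<bar> \<le> 2 * real q"
proof (cases "m \<le> j")
  case True
  then have "{..<Suc j} = {..<m} \<union> {m..j}" by auto
  then have "(\<Sum>k<Suc j. \<phi> k) = (\<Sum>k<m. \<phi> k) + (\<Sum>k=m..j. \<phi> k)"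
    by (simp add: sum.union_disjoint ivl_disj_int)
  then show ?thesis
    using sum_lessThan_bound [of "Suc j"] sum_lessThan_bound [of m] by simp
qed simp

text \<open>The limit is \<open>L(1, \<phi>)\<close>. Abel summation against \<open>1 / n\<close>
  bounds the tails, which gives both the Cauchy property and the rate.\<close>

lemma ex_L:
  obtains L where "\<And>N. \<bar>(\<Sum>n=1..N. \<phi> n / real n) - L\<bar> \<le> 2 * real q / real (Suc N)"
proof -
  define s where "s N = (\<Sum>n=1..N. \<phi> n / real n)" for N
  have diff: "\<bar>s M - s N\<bar> \<le> 2 * real q / real (Suc N)" if "N \<le> M" for M N
  proof -
    have "{1..M} = {1..N} \<union> {Suc N..M}" using that by auto
    then have "s M = s N + (\<Sum>n=Suc N..M. \<phi> n / real n)"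
      unfolding s_def by (simp add: sum.union_disjoint)
    moreover have "\<bar>\<Sum>n=Suc N..M. \<phi> n * (1 / real n)\<bar> \<le> 2 * real q * (1 / real (Suc N))"
      by (rule abel_sum_bound [where b = "\<lambda>n. 1 / real n", OF sum_interval_bound]) (auto intro!: divide_left_mono)
    ultimately show ?thesis by simp
  qed
  have "Cauchy s"
  proof (rule CauchyI)
    fix e :: real assume e: "0 < e"
    obtain K where K: "4 * real q / e < real K"
      using reals_Archimedean2 by blast
    have K2: "2 * real q / real (Suc K) < e / 2"
      using K e by (simp add: field_simps)
    have "norm (s m - s n) < e" if "K \<le> m" "K \<le> n" for m n
      using diff [OF that(1)] diff [OF that(2)] K2 by simp
    then show "\<exists>M. \<forall>m\<ge>M. \<forall>n\<ge>M. norm (s m - s n) < e" by blast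
  qed
  then obtain L where L: "s \<longlonglongrightarrow> L"
    using Cauchy_convergent_iff convergent_def by blast
  have "\<bar>s N - L\<bar> \<le> 2 * real q / real (Suc N)" for N
  proof -
    have "(\<lambda>M. \<bar>s M - s N\<bar>) \<longlonglongrightarrow> \<bar>L - s N\<bar>"
      by (intro tendsto_intros L)
    then have "\<bar>L - s N\<bar> \<le> 2 * real q / real (Suc N)"
      by (rule LIMSEQ_le_const2) (use diff in blast)
    then show ?thesis by simp
  qed
  then show ?thesis
    using that unfolding s_def by blast
qed

text \<open>Up to truncation the left side is the Lambert series with terms
  \<open>\<phi> d * t ^ d / (1 - t ^ d)\<close>. Rewriting these through
  \<open>lambert_weight\<close> leaves the sum of \<open>\<phi> d / d\<close>, small by
  \<open>L0\<close>, and a sum that Abel summation bounds by \<open>2 * q\<close>, as the first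
  weight is 1.\<close>

lemma lambert_bound:
  assumes L0: "\<And>N. \<bar>\<Sum>n=1..N. \<phi> n / real n\<bar> \<le> 2 * real q / real (Suc N)"
    and t: "0 < t" "t < 1"
  shows "(\<Sum>k=1..N. divisor_sum k * t ^ k)
    \<le> 2 * real q + (2 * real q / real (Suc N) + real N * t ^ N) / (1 - t)"
proof -
  have tpow: "t ^ d \<le> t" if "1 \<le> d" for d
    using power_decreasing [of 1 d t] that t by simp
  have inner: "\<bar>(\<Sum>m=1..N div d. t ^ (d * m)) - t ^ d / (1 - t ^ d)\<bar> \<le> t ^ N / (1 - t)" if d: "1 \<le> d" for d
  proof -
    define M where "M = N div d"
    \<comment> \<open>The first omitted exponent exceeds \<open>N\<close>, so the geometric tail is
      controlled by \<open>t ^ N\<close> uniformly in \<open>d\<close>.\<close>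
    have "N < d * Suc M"
      using d dividend_less_times_div [of d N] unfolding M_def by simp
    have d1: "t ^ d < 1" "1 - t \<le> 1 - t ^ d" using tpow [OF d] t by auto
    have "(1 - x) * (\<Sum>m=1..M. x ^ m) = x - x ^ Suc M" for x :: real
    proof (induction M)
      case (Suc M)
      have "(1 - x) * (\<Sum>m=1..Suc M. x ^ m) = (1 - x) * (\<Sum>m=1..M. x ^ m) + (1 - x) * x ^ Suc M"
        by (simp add: distrib_left)
      also have "\<dots> = x - x ^ Suc M + (1 - x) * x ^ Suc M"
        by (simp only: Suc)
      also have "\<dots> = x - x ^ Suc (Suc M)"
        by (simp add: algebra_simps)
      finally show ?case .
    qed simp
    from this [of "t ^ d"] have "(\<Sum>m=1..M. (t ^ d) ^ m) = (t ^ d - (t ^ d) ^ Suc M) / (1 - t ^ d)"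
      using d1 by (simp add: nonzero_eq_divide_eq mult.commute)
    then have "(\<Sum>m=1..N div d. t ^ (d * m)) - t ^ d / (1 - t ^ d) = - (t ^ (d * Suc M) / (1 - t ^ d))"
      unfolding M_def [symmetric] by (simp only: power_mult diff_divide_distrib)
    then have "\<bar>(\<Sum>m=1..N div d. t ^ (d * m)) - t ^ d / (1 - t ^ d)\<bar> = t ^ (d * Suc M) / (1 - t ^ d)"
      using t d1 by (simp only: abs_minus_cancel) (simp add: abs_of_nonneg)
    also have "\<dots> \<le> t ^ N / (1 - t)"
      using t d1 \<open>N < d * Suc M\<close> by (intro frac_le power_decreasing) auto
    finally show ?thesis .
  qed
  have "(\<Sum>k=1..N. divisor_sum k * t ^ k) = (\<Sum>k=1..N. \<Sum>d | d dvd k. \<phi> d * t ^ (d * (k div d)))"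
    unfolding divisor_sum_def sum_distrib_right by (intro sum.cong refl) simp
  also have "\<dots> = (\<Sum>d=1..N. \<Sum>m=1..N div d. \<phi> d * t ^ (d * m))"
    by (rule sum_divisor_pairs)
  also have "\<dots> = (\<Sum>d=1..N. \<phi> d * (\<Sum>m=1..N div d. t ^ (d * m)))"
    by (simp add: sum_distrib_left)
  also have "\<dots> \<le> (\<Sum>d=1..N. \<phi> d * (t ^ d / (1 - t ^ d)) + t ^ N / (1 - t))"
  proof (intro sum_mono)
    fix d assume "d \<in> {1..N}"
    then have "\<bar>\<phi> d * ((\<Sum>m=1..N div d. t ^ (d * m)) - t ^ d / (1 - t ^ d))\<bar> \<le> 1 * (t ^ N / (1 - t))"
      unfolding abs_mult using inner [of d] abs_le_1 [of d] by (intro mult_mono) auto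
    then show "\<phi> d * (\<Sum>m=1..N div d. t ^ (d * m)) \<le> \<phi> d * (t ^ d / (1 - t ^ d)) + t ^ N / (1 - t)"
      unfolding right_diff_distrib by linarith
  qed
  also have "\<dots> = (\<Sum>d=1..N. \<phi> d * (t ^ d / (1 - t ^ d))) + real N * t ^ N / (1 - t)"
    by (simp add: sum.distrib)
  also have "(\<Sum>d=1..N. \<phi> d * (t ^ d / (1 - t ^ d)))
      = (\<Sum>d=1..N. \<phi> d / real d) / (1 - t) - (\<Sum>d=1..N. \<phi> d * lambert_weight t d)"
    by (simp add: lambert_weight_def sum_divide_distrib sum_subtractf [symmetric] algebra_simps)
  also have "(\<Sum>d=1..N. \<phi> d / real d) / (1 - t) \<le> (2 * real q / real (Suc N)) / (1 - t)"
    using L0 [of N] t by (intro divide_right_mono) auto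
  finally have "(\<Sum>k=1..N. divisor_sum k * t ^ k) \<le> 2 * real q / real (Suc N) / (1 - t)
      - (\<Sum>d=1..N. \<phi> d * lambert_weight t d) + real N * t ^ N / (1 - t)"
    by simp
  moreover have "- (\<Sum>d=1..N. \<phi> d * lambert_weight t d) \<le> 2 * real q"
  proof -
    have "\<bar>\<Sum>d=1..N. \<phi> d * lambert_weight t d\<bar> \<le> 2 * real q * lambert_weight t 1"
      by (rule abel_sum_bound [where b = "lambert_weight t"])
         (use t in \<open>auto intro!: sum_interval_bound lambert_weight_decreasing lambert_weight_nonneg\<close>)
    then show ?thesis using lambert_weight_1 [OF t] by simp
  qed
  ultimately show ?thesis by (simp add: add_divide_distrib)
qed

text \<open>If \<open>L = 0\<close>, then \<open>lambert_bound\<close> with \<open>N\<close> tending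
  to infinity bounds the power series of \<open>divisor_sum\<close> by \<open>2 * q\<close> for
  every \<open>t\<close> between 0 and 1. The squares alone contribute at least
  \<open>t ^ j\<^sup>2\<close> each, and as \<open>t\<close> tends to 1 these terms merely count the
  squares.\<close>

lemma L_nonzero:
  assumes L: "\<And>N. \<bar>(\<Sum>n=1..N. \<phi> n / real n) - L\<bar> \<le> 2 * real q / real (Suc N)"
  shows "L \<noteq> 0"
proof
  assume "L = 0"
  then have L0: "\<bar>\<Sum>n=1..N. \<phi> n / real n\<bar> \<le> 2 * real q / real (Suc N)" for N
    using L [of N] by simp
  \<comment> \<open>One more square than the bound \<open>2 * q\<close> allows.\<close>
  define K where "K = 2 * q + 1"
  have squares: "(\<Sum>j=1..K. t ^ j\<^sup>2) \<le> 2 * real q" if t: "0 < t" "t < 1" for t :: real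
  proof -
    have "(\<Sum>j=1..K. t ^ j\<^sup>2) \<le> 2 * real q + (2 * real q / real (Suc N) + real N * t ^ N) / (1 - t)"
      if N: "K\<^sup>2 \<le> N" for N
    proof -
      have inj: "inj_on (\<lambda>j. j\<^sup>2) {1..K}"
        by (rule inj_onI) (simp add: power2_eq_iff_nonneg)
      have "(\<Sum>j=1..K. t ^ j\<^sup>2) \<le> (\<Sum>j=1..K. divisor_sum (j\<^sup>2) * t ^ j\<^sup>2)"
      proof (intro sum_mono)
        fix j assume "j \<in> {1..K}"
        then show "t ^ j\<^sup>2 \<le> divisor_sum (j\<^sup>2) * t ^ j\<^sup>2"
          using divisor_sum_square [of j] t by simp
      qed
      also have "\<dots> = (\<Sum>k\<in>(\<lambda>j. j\<^sup>2) ` {1..K}. divisor_sum k * t ^ k)"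
        by (subst sum.reindex [OF inj]) simp
      also have "\<dots> \<le> (\<Sum>k=1..N. divisor_sum k * t ^ k)"
      proof (intro sum_mono2)
        show "(\<lambda>j. j\<^sup>2) ` {1..K} \<subseteq> {1..N}"
        proof clarify
          fix j assume "j \<in> {1..K}"
          then have "1 \<le> j\<^sup>2" "j\<^sup>2 \<le> K\<^sup>2" by (auto intro: power_mono)
          then show "j\<^sup>2 \<in> {1..N}"
            using order.trans [OF _ N] by (simp del: power_mono_iff)
        qed
        show "0 \<le> divisor_sum k * t ^ k" if "k \<in> {1..N} - (\<lambda>j. j\<^sup>2) ` {1..K}" for k
          using that t divisor_sum_nonneg [of k] by simp
      qed simp
      also note lambert_bound [OF L0 t, of N]
      finally show ?thesis .
    qed
    moreover have "(\<lambda>N. 2 * real q + (2 * real q / real (Suc N) + real N * t ^ N) / (1 - t))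
        \<longlonglongrightarrow> 2 * real q + (0 + 0) / (1 - t)"
    proof (intro tendsto_intros)
      show "(\<lambda>N. 2 * real q / real (Suc N)) \<longlonglongrightarrow> 0"
        using LIMSEQ_Suc [OF lim_const_over_n [of "2 * real q"]] by simp
      show "(\<lambda>N. real N * t ^ N) \<longlonglongrightarrow> 0"
        using powser_times_n_limit_0 [of t] t by simp
    qed (use t in simp)
    ultimately have "(\<Sum>j=1..K. t ^ j\<^sup>2) \<le> 2 * real q + (0 + 0) / (1 - t)"
      by (intro LIMSEQ_le_const) blast+
    then show ?thesis by simp
  qed
  have "((\<lambda>t::real. \<Sum>j=1..K. t ^ j\<^sup>2) \<longlongrightarrow> (\<Sum>j=1..K. 1 ^ j\<^sup>2)) (at_left 1)"
    by (intro tendsto_intros)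
  moreover have "\<forall>\<^sub>F t in at_left (1::real). (\<Sum>j=1..K. t ^ j\<^sup>2) \<le> 2 * real q"
    using eventually_at_left_real [of 0 "1::real"] squares by (auto elim: eventually_mono)
  ultimately have "(\<Sum>j=1..K. 1 ^ j\<^sup>2) \<le> 2 * real q"
    by (rule tendsto_upperbound) simp
  then show False by (simp add: K_def)
qed

end

section \<open>Sums of characters against \<open>mangoldt\<close>\<close>

context real_character
begin

text \<open>\<open>ln n\<close> is the sum of \<open>mangoldt d\<close> over the divisors
  \<open>d\<close> of \<open>n\<close>, and multiplicativity splits \<open>\<phi> n\<close> over the
  two factors.\<close>

lemma sum_ln_convolution:
  "(\<Sum>n=1..N. \<phi> n * (ln (real n) / real n))
    = (\<Sum>d=1..N. \<phi> d * mangoldt d / real d * (\<Sum>m=1..N div d. \<phi> m / real m))"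
proof -
  have "(\<Sum>n=1..N. \<phi> n * (ln (real n) / real n))
      = (\<Sum>n=1..N. \<Sum>d | d dvd n. \<phi> d * mangoldt d / real d * (\<phi> (n div d) / real (n div d)))"
  proof (intro sum.cong refl)
    fix n assume n: "n \<in> {1..N}"
    have "\<phi> n * (ln (real n) / real n) = (\<Sum>d | d dvd n. \<phi> n * (mangoldt d / real n))"
      using mangoldt_sum [of n, where ?'a = real] n
      by (simp add: sum_distrib_left [symmetric] sum_divide_distrib [symmetric])
    also have "\<dots> = (\<Sum>d | d dvd n. \<phi> d * mangoldt d / real d * (\<phi> (n div d) / real (n div d)))"
    proof (intro sum.cong refl)
      fix d assume "d \<in> {d. d dvd n}"
      then obtain m where "n = d * m" by auto
      with n show "\<phi> n * (mangoldt d / real n) = \<phi> d * mangoldt d / real d * (\<phi> (n div d) / real (n div d))"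
        by (simp add: mult)
    qed
    finally show "\<phi> n * (ln (real n) / real n)
      = (\<Sum>d | d dvd n. \<phi> d * mangoldt d / real d * (\<phi> (n div d) / real (n div d)))" .
  qed
  also have "\<dots> = (\<Sum>d=1..N. \<Sum>m=1..N div d. \<phi> d * mangoldt d / real d * (\<phi> m / real m))"
    by (rule sum_divisor_pairs)
  finally show ?thesis by (simp only: sum_distrib_left)
qed

text \<open>At the numbers \<open>1 + Suc j * q\<close> the character is 1, and they are at most
  \<open>2 * q * Suc j\<close>; so they already contribute a multiple of the harmonic
  series.\<close>

lemma sum_over_n_unbounded:
  assumes H: "\<And>N. (\<Sum>n=1..N. \<phi> n / real n) \<le> C" and nn: "\<And>n. 0 \<le> \<phi> n"
  shows False
proof -
  have "(\<Sum>j<J. 1 / real (Suc j)) \<le> 2 * real q * C" for J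
  proof -
    have inj: "inj_on (\<lambda>j. 1 + Suc j * q) {..<J}"
      using period_pos by (auto intro!: inj_onI)
    have "(\<Sum>j<J. 1 / real (Suc j)) = 2 * real q * (\<Sum>j<J. 1 / (2 * real q * real (Suc j)))"
      using period_pos by (simp add: sum_distrib_left)
    also have "(\<Sum>j<J. 1 / (2 * real q * real (Suc j))) \<le> (\<Sum>j<J. \<phi> (1 + Suc j * q) / real (1 + Suc j * q))"
    proof (intro sum_mono)
      fix j
      have "\<phi> (1 + Suc j * q) = 1"
        using periodic [of "1 + Suc j * q"] periodic [of 1] one by (simp only: mod_mult_self1) simp
      moreover have "1 + Suc j * q \<le> 2 * q * Suc j"
        using period_pos by (cases q) auto
      then have "real (1 + Suc j * q) \<le> real (2 * q * Suc j)"
        by (rule of_nat_mono)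
      ultimately show "1 / (2 * real q * real (Suc j)) \<le> \<phi> (1 + Suc j * q) / real (1 + Suc j * q)"
        by (simp only:) (intro frac_le; simp add: algebra_simps)
    qed
    also have "\<dots> = (\<Sum>n\<in>(\<lambda>j. 1 + Suc j * q) ` {..<J}. \<phi> n / real n)"
      by (subst sum.reindex [OF inj]) simp
    also have "\<dots> \<le> (\<Sum>n=1..1 + J * q. \<phi> n / real n)"
    proof (rule sum_mono2)
      show "(\<lambda>j. 1 + Suc j * q) ` {..<J} \<subseteq> {1..1 + J * q}"
      proof (rule image_subsetI)
        fix j assume "j \<in> {..<J}"
        then have "Suc j * q \<le> J * q" by (intro mult_le_mono1) simp
        then show "1 + Suc j * q \<in> {1..1 + J * q}" by simp
      qed
    qed (use nn in auto)
    also have "\<dots> \<le> C" by (rule H)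
    finally show ?thesis by (simp add: mult_left_mono)
  qed
  then have "summable (\<lambda>j. 1 / real (Suc j))"
    by (intro summableI_nonneg_bounded) auto
  then have "summable (\<lambda>n. 1 / real n)"
    by (subst (asm) summable_Suc_iff)
  then show False
    using not_summable_harmonic [where ?'a = real] by (simp add: inverse_eq_divide)
qed

text \<open>A bound \<open>C\<close> would make the sum weighted by \<open>ln n / n\<close> at most
  \<open>C * H N\<close>. Beyond \<open>M\<close> the logarithm exceeds \<open>2 * C\<close>, hence
  \<open>2 * C * (H N - H M) \<le> C * H N\<close>, and \<open>H\<close> would be bounded by
  \<open>2 * H M\<close>.\<close>

lemma sum_mangoldt_unbounded:
  assumes nn: "\<And>n. 0 \<le> \<phi> n"
  shows "\<not> (\<exists>C. \<forall>N. (\<Sum>d=1..N. \<phi> d * mangoldt d / real d) \<le> C)"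
proof
  assume "\<exists>C. \<forall>N. (\<Sum>d=1..N. \<phi> d * mangoldt d / real d) \<le> C"
  then obtain C0 where C0: "\<And>N. (\<Sum>d=1..N. \<phi> d * mangoldt d / real d) \<le> C0"
    by blast
  \<comment> \<open>Adding 1 makes \<open>C\<close> positive, so that it can be cancelled at the
    end.\<close>
  define C where "C = C0 + 1"
  have C: "(\<Sum>d=1..N. \<phi> d * mangoldt d / real d) \<le> C" for N
    using C0 [of N] by (simp add: C_def)
  have "0 < C" using C0 [of 0] by (simp add: C_def)
  define H where "H N = (\<Sum>n=1..N. \<phi> n / real n)" for N
  have H_mono: "H M \<le> H N" if "M \<le> N" for M N
    unfolding H_def using that nn by (intro sum_mono2) auto
  have H_nonneg: "0 \<le> H N" for N
    unfolding H_def using nn by (intro sum_nonneg) auto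
  obtain M where M: "exp (2 * C) < real M"
    using reals_Archimedean2 by blast
  have "H N \<le> 2 * H M" for N
  proof (cases "M \<le> N")
    case True
    have "{1..N} = {1..M} \<union> {Suc M..N}" using True by auto
    then have "H N = H M + (\<Sum>n=Suc M..N. \<phi> n / real n)"
      unfolding H_def by (simp add: sum.union_disjoint)
    then have "2 * C * (H N - H M) = (\<Sum>n=Suc M..N. \<phi> n * (2 * C / real n))"
      by (simp add: sum_distrib_left algebra_simps)
    also have "\<dots> \<le> (\<Sum>n=Suc M..N. \<phi> n * (ln (real n) / real n))"
    proof (intro sum_mono mult_left_mono divide_right_mono nn)
      fix n assume "n \<in> {Suc M..N}"
      then have "exp (2 * C) < real n" using M by simp
      then show "2 * C \<le> ln (real n)"
        by (metis exp_gt_zero less_eq_real_def ln_exp ln_less_cancel_iff order_less_trans)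
    qed auto
    also have "\<dots> \<le> (\<Sum>n=1..N. \<phi> n * (ln (real n) / real n))"
      using nn by (intro sum_mono2) auto
    also have "\<dots> = (\<Sum>d=1..N. \<phi> d * mangoldt d / real d * H (N div d))"
      unfolding H_def by (rule sum_ln_convolution)
    also have "\<dots> \<le> (\<Sum>d=1..N. \<phi> d * mangoldt d / real d * H N)"
      using nn by (intro sum_mono mult_left_mono H_mono) (auto intro!: divide_nonneg_nonneg mult_nonneg_nonneg mangoldt_nonneg)
    also have "\<dots> = (\<Sum>d=1..N. \<phi> d * mangoldt d / real d) * H N"
      by (simp add: sum_distrib_right)
    also have "\<dots> \<le> C * H N"
      using C H_nonneg by (intro mult_right_mono)
    finally have "C * (2 * (H N - H M)) \<le> C * H N"
      by (simp only: mult.assoc mult.left_commute [of C 2])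
    then show ?thesis using \<open>0 < C\<close> by simp
  next
    case False
    then show ?thesis using H_mono [of N M] H_nonneg [of M] by simp
  qed
  then show False
    using sum_over_n_unbounded nn unfolding H_def by blast
qed

end

context nonprincipal_real_character
begin

text \<open>\<open>ln x / x\<close> decreases only from \<open>exp 1\<close> on, so Abel summation
  starts at 3 and the terms up to 2 are bounded separately.\<close>

lemma sum_ln_bounded:
  "\<bar>\<Sum>n=1..N. \<phi> n * (ln (real n) / real n)\<bar> \<le> 2 * real q * (ln 3 / 3) + (\<Sum>n\<le>2. \<bar>\<phi> n * (ln (real n) / real n)\<bar>)"
proof -
  let ?f = "\<lambda>n. \<phi> n * (ln (real n) / real n)"
  have "\<bar>\<Sum>n=3..N. ?f n\<bar> \<le> 2 * real q * (ln (real 3) / real 3)"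
  proof (rule abel_sum_bound [OF sum_interval_bound])
    fix k :: nat assume k: "3 \<le> k"
    then have "exp 1 \<le> real k" using exp_le by (simp add: order.trans)
    then show "ln (real (Suc k)) / real (Suc k) \<le> ln (real k) / real k"
      by (intro ln_x_over_x_mono) auto
    show "0 \<le> ln (real k) / real k" using k by simp
  qed
  moreover have "(\<Sum>n=1..N. ?f n) = (\<Sum>n\<in>{1..N} \<inter> {..2}. ?f n) + (\<Sum>n=3..N. ?f n)"
  proof -
    have "(\<Sum>n=1..N. ?f n) = sum ?f (({1..N} \<inter> {..2}) \<union> {3..N})"
      by (rule arg_cong [where f = "sum ?f"]) auto
    also have "\<dots> = (\<Sum>n\<in>{1..N} \<inter> {..2}. ?f n) + (\<Sum>n=3..N. ?f n)"
      by (rule sum.union_disjoint) auto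
    finally show ?thesis .
  qed
  moreover have "\<bar>\<Sum>n\<in>{1..N} \<inter> {..2}. ?f n\<bar> \<le> (\<Sum>n\<le>2. \<bar>?f n\<bar>)"
    by (rule order.trans [OF sum_abs]) (intro sum_mono2; auto)
  ultimately show ?thesis by simp
qed

text \<open>In \<open>sum_ln_convolution\<close> the inner sums are replaced by \<open>L\<close>.
  The error at \<open>d\<close> is at most \<open>2 * q / N * mangoldt d\<close>, which sums to a
  constant by Chebyshev's bound. What remains is \<open>L\<close> times the wanted sum, and
  \<open>L\<close> is nonzero.\<close>

lemma sum_mangoldt_bounded: "\<exists>C. \<forall>N. \<bar>\<Sum>d=1..N. \<phi> d * mangoldt d / real d\<bar> \<le> C"
proof -
  obtain L where L: "\<And>N. \<bar>(\<Sum>n=1..N. \<phi> n / real n) - L\<bar> \<le> 2 * real q / real (Suc N)"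
    using ex_L by blast
  have "L \<noteq> 0" using L_nonzero L by blast
  define B where "B = 2 * real q * (ln 3 / 3) + (\<Sum>n\<le>2. \<bar>\<phi> n * (ln (real n) / real n)\<bar>)"
  have "\<bar>\<Sum>d=1..N. \<phi> d * mangoldt d / real d\<bar> \<le> (B + 2 * real q * (4 * ln 4)) / \<bar>L\<bar>" for N
  proof -
    define A where "A = (\<Sum>d=1..N. \<phi> d * mangoldt d / real d)"
    let ?D = "\<lambda>d. \<phi> d * mangoldt d / real d * ((\<Sum>m=1..N div d. \<phi> m / real m) - L)"
    have D_le: "\<bar>?D d\<bar> \<le> 2 * real q / real N * mangoldt d" if d: "d \<in> {1..N}" for d
    proof -
      have "N < d * Suc (N div d)"
        using d dividend_less_times_div [of d N] by simp
      then have "real N \<le> real (d * Suc (N div d))"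
        by (intro of_nat_mono) simp
      then have frac: "2 * real q / (real d * real (Suc (N div d))) \<le> 2 * real q / real N"
        using d by (intro frac_le) (auto simp: algebra_simps)
      have "\<bar>?D d\<bar> = \<bar>\<phi> d\<bar> * (mangoldt d / real d * \<bar>(\<Sum>m=1..N div d. \<phi> m / real m) - L\<bar>)"
        by (simp add: abs_mult mangoldt_nonneg)
      also have "\<dots> \<le> 1 * (mangoldt d / real d * (2 * real q / real (Suc (N div d))))"
        using abs_le_1 L [of "N div d"] by (intro mult_mono mult_left_mono) (auto simp: mangoldt_nonneg)
      also have "\<dots> = mangoldt d * (2 * real q / (real d * real (Suc (N div d))))"
        by simp
      also have "\<dots> \<le> mangoldt d * (2 * real q / real N)"
        using frac by (intro mult_left_mono mangoldt_nonneg)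
      finally show ?thesis by (simp add: mult.commute)
    qed
    have "(\<Sum>n=1..N. \<phi> n * (ln (real n) / real n)) - L * A = (\<Sum>d=1..N. ?D d)"
      unfolding sum_ln_convolution A_def sum_distrib_left sum_subtractf [symmetric]
      by (intro sum.cong refl) (simp only: right_diff_distrib sum_distrib_left mult.commute [of L])
    also have "\<bar>\<dots>\<bar> \<le> (\<Sum>d=1..N. 2 * real q / real N * mangoldt d)"
      by (rule order.trans [OF sum_abs]) (intro sum_mono D_le)
    also have "\<dots> = 2 * real q / real N * chebyshev_psi N"
      by (simp add: chebyshev_psi_def sum_distrib_left)
    also have "\<dots> \<le> 2 * real q / real N * (4 * ln 4 * real N)"
      by (intro mult_left_mono chebyshev_psi_le) auto
    also have "\<dots> \<le> 2 * real q * (4 * ln 4)"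
      by (cases "N = 0") auto
    finally have "\<bar>L * A\<bar> \<le> B + 2 * real q * (4 * ln 4)"
      using sum_ln_bounded [of N] unfolding B_def by linarith
    then show ?thesis
      using \<open>L \<noteq> 0\<close> unfolding A_def by (simp add: abs_mult pos_le_divide_eq mult.commute)
  qed
  then show ?thesis by blast
qed

end

section \<open>Primes with prescribed quadratic characters\<close>

text \<open>
  Bounds the contribution of even prime powers, at which the characters give no information on the
  underlying prime.
\<close>

lemma mangoldt_squares_bounded:
  "\<exists>C. \<forall>N. (\<Sum>m=1..N. mangoldt (m\<^sup>2) / real (m\<^sup>2)) \<le> (C::real)"
proof -
  let ?g = "\<lambda>m. 4 * real m powr (-3/2)"
  have sg: "summable ?g"
    by (intro summable_mult) (subst summable_real_powr_iff, simp)
  have "mangoldt (m\<^sup>2) / real (m\<^sup>2) \<le> ?g m" if m: "1 \<le> m" for m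
  proof -
    have m2: "real (m\<^sup>2) = real m powr 2"
      by (simp add: powr_numeral)
    have "mangoldt (m\<^sup>2) \<le> ln (real (m\<^sup>2))"
      using m by (intro mangoldt_le) auto
    \<comment> \<open>The exponent \<open>1/4\<close> bounds the logarithm by
      \<open>4 * m powr (1/2)\<close>, leaving the summable power \<open>-3/2\<close> after division
      by \<open>m\<^sup>2\<close>.\<close>
    also have "\<dots> \<le> real (m\<^sup>2) powr (1/4) / (1/4)"
      using m by (intro ln_powr_bound) auto
    also have "\<dots> = 4 * real m powr (1/2)"
      unfolding m2 powr_powr by simp
    finally have "mangoldt (m\<^sup>2) / real (m\<^sup>2) \<le> 4 * real m powr (1/2) / real m powr 2"
      unfolding m2 by (intro divide_right_mono) auto
    also have "\<dots> = 4 * real m powr (1/2 - 2)"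
      by (simp only: powr_diff times_divide_eq_right)
    finally show ?thesis by simp
  qed
  then have "(\<Sum>m=1..N. mangoldt (m\<^sup>2) / real (m\<^sup>2)) \<le> suminf ?g" for N
    by (intro order.trans [OF sum_mono sum_le_suminf [OF sg]]) auto
  then show ?thesis by blast
qed

text \<open>Each character is indexed by its modulus. Coprimality of the moduli makes the characters
  independent through the Chinese remainder theorem.\<close>

locale independent_real_characters =
  fixes W :: "nat set" and \<psi> :: "nat \<Rightarrow> nat \<Rightarrow> real"
  assumes finite_W: "finite W"
    and coprime_W: "v \<in> W \<Longrightarrow> w \<in> W \<Longrightarrow> v \<noteq> w \<Longrightarrow> coprime v w"
    and character: "w \<in> W \<Longrightarrow> nonprincipal_real_character (\<psi> w) w"
    and zero_imp_not_coprime: "w \<in> W \<Longrightarrow> coprime n w \<Longrightarrow> \<psi> w n \<noteq> 0"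
begin

text \<open>The characters outside \<open>T\<close> enter squared, as principal ones. Thus all these
  products have the common period \<open>\<Prod>W\<close> and the same zeros, and
  \<open>T = {}\<close> gives the principal character.\<close>

definition prod_character :: "nat set \<Rightarrow> nat \<Rightarrow> real"
  where "prod_character T n = (\<Prod>w\<in>T. \<psi> w n) * (\<Prod>w\<in>W - T. (\<psi> w n)\<^sup>2)"

lemma real_character_W: "w \<in> W \<Longrightarrow> real_character (\<psi> w) w"
  using character nonprincipal_real_character_def by blast

lemma character_values: "w \<in> W \<Longrightarrow> \<psi> w n \<in> {-1, 0, 1}"
  using real_character.range real_character_W by blast

lemma real_character_prod:
  assumes T: "T \<subseteq> W"
  shows "real_character (prod_character T) (\<Prod>W)"
proof
  note rc = real_character_W [THEN real_character.period_pos] real_character_W [THEN real_character.mult]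
    real_character_W [THEN real_character.one] real_character_W [THEN real_character.periodic]
  show "0 < \<Prod>W"
    using rc(1) by (auto intro!: prod_pos)
  show "prod_character T (m * n) = prod_character T m * prod_character T n" for m n
  proof -
    have "(\<Prod>w\<in>T. \<psi> w (m * n)) = (\<Prod>w\<in>T. \<psi> w m * \<psi> w n)"
      using T rc(2) by (intro prod.cong) auto
    moreover have "(\<Prod>w\<in>W - T. (\<psi> w (m * n))\<^sup>2) = (\<Prod>w\<in>W - T. (\<psi> w m)\<^sup>2 * (\<psi> w n)\<^sup>2)"
      using rc(2) by (intro prod.cong) (auto simp: power_mult_distrib)
    ultimately show ?thesis
      by (simp add: prod_character_def prod.distrib)
  qed
  show "prod_character T (Suc 0) = 1"
  proof -
    have "(\<Prod>w\<in>T. \<psi> w (Suc 0)) = 1"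
      using T rc(3) by (intro prod.neutral) auto
    moreover have "(\<Prod>w\<in>W - T. (\<psi> w (Suc 0))\<^sup>2) = 1"
      using rc(3) by (intro prod.neutral) auto
    ultimately show ?thesis by (simp add: prod_character_def)
  qed
  show "prod_character T n \<in> {-1, 0, 1}" for n
  proof -
    have closed: "(\<Prod>w\<in>A. f w) \<in> {-1, 0, 1}" if "\<And>w. w \<in> A \<Longrightarrow> f w \<in> {-1, 0, 1::real}" for A :: "nat set" and f
      using that
    proof (induction A rule: infinite_finite_induct)
      case (insert x A)
      then have "f x \<in> {-1, 0, 1}" "(\<Prod>w\<in>A. f w) \<in> {-1, 0, 1}" by blast+
      then show ?case unfolding prod.insert [OF insert.hyps] by auto
    qed auto
    have "(\<Prod>w\<in>T. \<psi> w n) \<in> {-1, 0, 1}"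
      using T by (intro closed character_values) auto
    moreover have "(\<Prod>w\<in>W - T. (\<psi> w n)\<^sup>2) \<in> {-1, 0, 1}"
      using character_values [of _ n] by (intro closed) fastforce
    ultimately show ?thesis by (auto simp: prod_character_def)
  qed
  show "prod_character T (n mod \<Prod>W) = prod_character T n" for n
  proof -
    have "\<psi> w (n mod \<Prod>W) = \<psi> w n" if w: "w \<in> W" for w
    proof -
      have "w dvd \<Prod>W" using w finite_W by (rule dvd_prodI [of W w "\<lambda>x. x", simplified, rotated])
      then have "n mod \<Prod>W mod w = n mod w" by (rule mod_mod_cancel)
      then show ?thesis using rc(4) [OF w, of n] rc(4) [OF w, of "n mod \<Prod>W"] by simp
    qed
    then have "(\<Prod>w\<in>T. \<psi> w (n mod \<Prod>W)) = (\<Prod>w\<in>T. \<psi> w n)"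
      "(\<Prod>w\<in>W - T. (\<psi> w (n mod \<Prod>W))\<^sup>2) = (\<Prod>w\<in>W - T. (\<psi> w n)\<^sup>2)"
      using T by (auto intro!: prod.cong)
    then show ?thesis by (simp add: prod_character_def)
  qed
qed

text \<open>The Chinese remainder theorem provides \<open>a\<close> at which one character of
  \<open>T\<close> is -1 and all others are 1.\<close>

lemma nonprincipal_prod:
  assumes T: "T \<subseteq> W" "T \<noteq> {}"
  shows "nonprincipal_real_character (prod_character T) (\<Prod>W)"
proof -
  interpret real_character "prod_character T" "\<Prod>W"
    by (rule real_character_prod [OF T(1)])
  obtain v where v: "v \<in> T" "v \<in> W" using T by blast
  obtain b where b: "coprime b v" "\<psi> v b = -1"
    using nonprincipal_real_character.nonprincipal [OF character [OF v(2)]] by blast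
  obtain a where a: "\<And>w. w \<in> W \<Longrightarrow> [a = (if w = v then b else 1)] (mod w)"
    using chinese_remainder_nat [OF finite_W, of "\<lambda>w. w" "\<lambda>w. if w = v then b else 1"] coprime_W
    by blast
  have cop: "coprime a w" if w: "w \<in> W" for w
    using cong_imp_coprime [OF cong_sym [OF a [OF w]]] b by (auto split: if_splits)
  have lam: "\<psi> w a = (if w = v then -1 else 1)" if w: "w \<in> W" for w
  proof -
    have "\<psi> w a = \<psi> w (if w = v then b else 1)"
      using real_character.periodic [OF real_character_W [OF w]] a [OF w] unfolding cong_def by metis
    then show ?thesis
      using b real_character.one [OF real_character_W [OF w]] by auto
  qed
  have "(\<Prod>w\<in>T. \<psi> w a) = (\<Prod>w\<in>T. if w = v then -1 else 1)"
    using T lam by (intro prod.cong) auto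
  also have "\<dots> = -1"
    using v finite_subset [OF T(1) finite_W] by (simp add: prod.delta)
  finally have "(\<Prod>w\<in>T. \<psi> w a) = -1" .
  moreover have "(\<Prod>w\<in>W - T. (\<psi> w a)\<^sup>2) = 1"
    using lam by (intro prod.neutral) auto
  ultimately have "prod_character T a = -1"
    by (simp add: prod_character_def)
  moreover have "coprime a (\<Prod>W)"
    using cop by (auto intro: prod_coprime_right)
  ultimately show ?thesis
    by unfold_locales blast
qed

text \<open>\<open>F\<close> detects the prescribed values and is a signed sum of product
  characters. Its sum against \<open>mangoldt n / n\<close> is unbounded, because only the principal
  summand is. Without such a prime, however, the sum would live on even prime powers and be
  bounded.\<close>

lemma ex_prime_with_values:
  fixes \<epsilon> :: "nat \<Rightarrow> real"
  assumes \<epsilon>: "\<And>w. w \<in> W \<Longrightarrow> \<epsilon> w \<in> {-1, 1}"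
  shows "\<exists>p. prime p \<and> (\<forall>w\<in>W. \<psi> w p = \<epsilon> w)"
proof (rule ccontr)
  assume no_prime: "\<not> ?thesis"
  \<comment> \<open>Each factor is 2 at the prescribed value and 0 at the other two, including the
    value 0; its square term is what \<open>prod_character\<close> uses outside
    \<open>T\<close>.\<close>
  define F where "F n = (\<Prod>w\<in>W. \<epsilon> w * \<psi> w n + (\<psi> w n)\<^sup>2)" for n
  define S where "S T N = (\<Sum>d=1..N. prod_character T d * mangoldt d / real d)" for T N
  have factor: "\<epsilon> w * \<psi> w n + (\<psi> w n)\<^sup>2 = (if \<psi> w n = \<epsilon> w then 2 else 0)" if "w \<in> W" for w n
    using character_values [OF that, of n] \<epsilon> [OF that] by auto
  have F_cases: "F n = (if \<forall>w\<in>W. \<psi> w n = \<epsilon> w then 2 ^ card W else 0)" for n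
  proof (cases "\<forall>w\<in>W. \<psi> w n = \<epsilon> w")
    case True
    then have "F n = (\<Prod>w\<in>W. 2)"
      unfolding F_def by (intro prod.cong refl) (subst factor; simp)
    then show ?thesis using True by simp
  next
    case False
    then show ?thesis unfolding F_def using finite_W by (auto simp: factor intro!: prod_zero)
  qed
  have F_expand: "F n = (\<Sum>T\<in>Pow W. (\<Prod>w\<in>T. \<epsilon> w) * prod_character T n)" for n
    unfolding F_def prod_add [OF finite_W] prod_character_def
    by (simp add: prod.distrib mult.assoc)
  have F_square: "n \<in> (\<lambda>m. m\<^sup>2) ` {1..n}" if n: "F n * mangoldt n \<noteq> 0" for n
  proof -
    have vals: "\<psi> w n = \<epsilon> w" if "w \<in> W" for w
      using n that F_cases [of n] by (auto split: if_splits)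
    have "primepow n" using n by (auto simp: mangoldt_def split: if_splits)
    then obtain p k where pk: "prime p" "0 < k" "n = p ^ k"
      unfolding primepow_def by blast
    have pow: "\<psi> w n = \<psi> w p ^ k" if "w \<in> W" for w
      using real_character.power [OF real_character_W [OF that]] pk by simp
    have "even k"
    \<comment> \<open>An odd power does not change a value in {-1, 0, 1}, so \<open>p\<close> itself
      would have the prescribed values.\<close>
    proof (rule ccontr)
      assume "odd k"
      have "\<psi> w p = \<epsilon> w" if w: "w \<in> W" for w
        using pow [OF w] vals [OF w] character_values [OF w, of p] \<open>odd k\<close> pk(2) by auto
      then show False using no_prime pk(1) by blast
    qed
    then have "n = (p ^ (k div 2))\<^sup>2"
      using pk by (simp add: power_mult [symmetric])
    moreover have "p ^ (k div 2) \<le> (p ^ (k div 2))\<^sup>2"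
      by (simp add: power2_eq_square)
    moreover have "1 \<le> p ^ (k div 2)"
      using prime_gt_0_nat [OF pk(1)] by simp
    ultimately show ?thesis by (intro image_eqI [of _ _ "p ^ (k div 2)"]) auto
  qed
  obtain C where C: "\<And>N. (\<Sum>m=1..N. mangoldt (m\<^sup>2) / real (m\<^sup>2)) \<le> C"
    using mangoldt_squares_bounded by blast
  have F_bound: "0 \<le> F n" "F n \<le> 2 ^ card W" for n
    by (auto simp: F_cases)
  have upper: "(\<Sum>n=1..N. F n * mangoldt n / real n) \<le> 2 ^ card W * C" for N
  proof -
    have "(\<Sum>n=1..N. F n * mangoldt n / real n)
        = (\<Sum>n | n \<in> {1..N} \<and> F n * mangoldt n \<noteq> 0. F n * mangoldt n / real n)"
      by (intro sum.mono_neutral_right) auto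
    also have "\<dots> \<le> (\<Sum>n\<in>(\<lambda>m. m\<^sup>2) ` {1..N}. F n * mangoldt n / real n)"
    proof (rule sum_mono2)
      show "{n. n \<in> {1..N} \<and> F n * mangoldt n \<noteq> 0} \<subseteq> (\<lambda>m. m\<^sup>2) ` {1..N}"
        using F_square by fastforce
    qed (use F_bound in \<open>auto intro!: divide_nonneg_nonneg mult_nonneg_nonneg mangoldt_nonneg\<close>)
    also have "\<dots> = (\<Sum>m=1..N. F (m\<^sup>2) * mangoldt (m\<^sup>2) / real (m\<^sup>2))"
      by (subst sum.reindex) (auto intro!: inj_onI simp: power2_eq_iff_nonneg)
    also have "\<dots> \<le> (\<Sum>m=1..N. 2 ^ card W * mangoldt (m\<^sup>2) / real (m\<^sup>2))"
      using F_bound by (intro sum_mono divide_right_mono mult_right_mono mangoldt_nonneg) auto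
    also have "\<dots> = 2 ^ card W * (\<Sum>m=1..N. mangoldt (m\<^sup>2) / real (m\<^sup>2))"
      by (simp add: sum_distrib_left)
    also have "\<dots> \<le> 2 ^ card W * C"
      using C by (intro mult_left_mono) auto
    finally show ?thesis .
  qed
  have "\<forall>T\<in>Pow W - {{}}. \<exists>D. \<forall>N. \<bar>S T N\<bar> \<le> D"
    unfolding S_def using nonprincipal_real_character.sum_mangoldt_bounded [OF nonprincipal_prod] by blast
  then obtain D where D: "\<And>T N. T \<in> Pow W - {{}} \<Longrightarrow> \<bar>S T N\<bar> \<le> D T"
    by metis
  have "S {} N \<le> 2 ^ card W * C + (\<Sum>T\<in>Pow W - {{}}. D T)" for N
  proof -
    have "(\<Sum>n=1..N. F n * mangoldt n / real n) = (\<Sum>n=1..N. \<Sum>T\<in>Pow W. (\<Prod>w\<in>T. \<epsilon> w) * (prod_character T n * mangoldt n / real n))"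
      by (simp add: F_expand sum_distrib_right sum_divide_distrib mult.assoc)
    also have "\<dots> = (\<Sum>T\<in>Pow W. (\<Prod>w\<in>T. \<epsilon> w) * S T N)"
      unfolding S_def sum_distrib_left by (rule sum.swap)
    also have "\<dots> = S {} N + (\<Sum>T\<in>Pow W - {{}}. (\<Prod>w\<in>T. \<epsilon> w) * S T N)"
      using finite_W by (subst sum.remove [of _ "{}"]) auto
    finally have "S {} N \<le> 2 ^ card W * C - (\<Sum>T\<in>Pow W - {{}}. (\<Prod>w\<in>T. \<epsilon> w) * S T N)"
      using upper [of N] by linarith
    also have "\<dots> = 2 ^ card W * C + (\<Sum>T\<in>Pow W - {{}}. - ((\<Prod>w\<in>T. \<epsilon> w) * S T N))"
      by (simp add: sum_negf)
    also have "\<dots> \<le> 2 ^ card W * C + (\<Sum>T\<in>Pow W - {{}}. D T)"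
    proof (intro add_left_mono sum_mono)
      fix T assume T: "T \<in> Pow W - {{}}"
      have "\<bar>\<epsilon> w\<bar> = 1" if "w \<in> T" for w
      proof -
        have "w \<in> W" using T that by blast
        then show ?thesis using \<epsilon> [of w] by auto
      qed
      then have "\<bar>\<Prod>w\<in>T. \<epsilon> w\<bar> = 1"
        by (simp add: abs_prod)
      then have "\<bar>(\<Prod>w\<in>T. \<epsilon> w) * S T N\<bar> \<le> D T"
        using D [OF T, of N] by (simp add: abs_mult)
      then show "- ((\<Prod>w\<in>T. \<epsilon> w) * S T N) \<le> D T" by linarith
    qed
    finally show ?thesis .
  qed
  moreover have "0 \<le> prod_character {} n" for n
    by (auto simp: prod_character_def intro!: prod_nonneg)
  ultimately show False
    using real_character.sum_mangoldt_unbounded [OF real_character_prod [of "{}"]]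
    unfolding S_def by blast
qed

end

section \<open>Legendre symbols and the character modulo 4\<close>

lemma Legendre_values: "Legendre a p \<in> {-1, 0, 1}"
  by (simp add: Legendre_def)

lemma Legendre_cong: "[a = b] (mod p) \<Longrightarrow> Legendre a p = Legendre b p"
  by (simp add: Legendre_def QuadRes_def cong_def)

text \<open>Euler's criterion gives the identity modulo \<open>p\<close>; the two sides differ by at
  most 2, which is less than \<open>p\<close>.\<close>

lemma Legendre_mult:
  fixes p :: nat
  assumes p: "prime p" "2 < p"
  shows "Legendre (a * b) (int p) = Legendre a (int p) * Legendre b (int p)"
proof -
  let ?k = "(p - 1) div 2"
  have "[Legendre (a * b) (int p) = (a * b) ^ ?k] (mod int p)"
    by (rule euler_criterion [OF p])
  moreover have "[Legendre a (int p) * Legendre b (int p) = a ^ ?k * b ^ ?k] (mod int p)"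
    by (intro cong_mult euler_criterion p)
  ultimately have "[Legendre (a * b) (int p) = Legendre a (int p) * Legendre b (int p)] (mod int p)"
    by (metis cong_sym cong_trans power_mult_distrib)
  then have dvd: "int p dvd Legendre (a * b) (int p) - Legendre a (int p) * Legendre b (int p)"
    by (simp add: cong_iff_dvd_diff)
  have "\<bar>Legendre (a * b) (int p) - Legendre a (int p) * Legendre b (int p)\<bar> \<le> 2"
    using Legendre_values [of a "int p"] Legendre_values [of b "int p"] Legendre_values [of "a * b" "int p"]
    by auto
  then show ?thesis
    using zdvd_imp_le [of "int p" "\<bar>Legendre (a * b) (int p) - Legendre a (int p) * Legendre b (int p)\<bar>"]
      dvd p(2) by fastforce
qed

text \<open>As \<open>x\<close> and \<open>p - x\<close> have the same square, at most
  \<open>(p - 1) div 2\<close> nonzero residues are squares.\<close>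

lemma ex_quadratic_nonresidue:
  fixes p :: nat
  assumes p: "prime p" "2 < p"
  shows "\<exists>a. coprime a p \<and> Legendre (int a) (int p) = -1"
proof (rule ccontr)
  assume *: "\<not> ?thesis"
  define f where "f x = x\<^sup>2 mod p" for x
  have surj: "{1..<p} \<subseteq> f ` {1..(p - 1) div 2}"
  proof
    fix a assume a: "a \<in> {1..<p}"
    then have "coprime a p"
      using p(1) by (metis atLeastLessThan_iff coprime_commute not_less_eq nat_dvd_not_less prime_imp_coprime
          One_nat_def Suc_le_eq)
    then have "Legendre (int a) (int p) \<noteq> -1" using * by blast
    moreover have "\<not> [int a = 0] (mod int p)"
      using a by (auto simp: cong_0_iff dest: dvd_imp_le)
    ultimately obtain y where y: "[y\<^sup>2 = int a] (mod int p)"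
      by (auto simp: Legendre_def QuadRes_def split: if_splits)
    define x where "x = nat (y mod int p)"
    have x: "int x = y mod int p" "x < p"
      using p by (auto simp: x_def nat_less_iff)
    have xa: "[int x ^ 2 = int a] (mod int p)"
      using y unfolding x(1) by (simp add: cong_def power_mod)
    then have xa': "[x\<^sup>2 = a] (mod p)"
      by (simp flip: cong_int_iff)
    then have fx: "f x = a" using a by (simp add: f_def cong_def)
    have "x \<noteq> 0"
    proof
      assume "x = 0"
      then have "f x = 0" by (simp add: f_def)
      then show False using fx a by simp
    qed
    show "a \<in> f ` {1..(p - 1) div 2}"
    proof (cases "x \<le> (p - 1) div 2")
      case True
      then show ?thesis using fx \<open>x \<noteq> 0\<close> by force
    next
      case False
      have "[int (p - x) ^ 2 = int x ^ 2] (mod int p)"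
      proof -
        have "int (p - x) ^ 2 - int x ^ 2 = int p * (int p - 2 * int x)"
          using x(2) by (simp add: of_nat_diff power2_eq_square algebra_simps)
        then show ?thesis by (simp add: cong_iff_dvd_diff)
      qed
      then have "[(p - x)\<^sup>2 = x\<^sup>2] (mod p)"
        by (simp flip: cong_int_iff)
      then have "f (p - x) = a"
        using fx by (simp add: f_def cong_def)
      moreover have "odd p" using prime_odd_nat [OF p] .
      then have "p - x \<in> {1..(p - 1) div 2}"
        using False x(2) by (auto elim!: oddE)
      ultimately show ?thesis by blast
    qed
  qed
  have "card {1..<p} \<le> card {1..(p - 1) div 2}"
    by (rule order.trans [OF card_mono [OF _ surj] card_image_le]) auto
  then show False using p(2) by simp
qed

lemma nonprincipal_real_character_Legendre:
  assumes p: "prime p" "2 < p"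
  shows "nonprincipal_real_character (\<lambda>n. real_of_int (Legendre (int n) (int p))) p"
proof
  show "0 < p" using p by simp
  show "real_of_int (Legendre (int (m * n)) (int p))
      = real_of_int (Legendre (int m) (int p)) * real_of_int (Legendre (int n) (int p))" for m n
    using Legendre_mult [OF p, of "int m" "int n"] by simp
  have "QuadRes (int p) 1"
    unfolding QuadRes_def by (rule exI [of _ 1]) simp
  then show "real_of_int (Legendre (int (Suc 0)) (int p)) = 1"
    using p by (simp add: Legendre_def cong_def)
  show "real_of_int (Legendre (int n) (int p)) \<in> {-1, 0, 1}" for n
    using Legendre_values [of "int n" "int p"] by auto
  show "real_of_int (Legendre (int (n mod p)) (int p)) = real_of_int (Legendre (int n) (int p))" for n
    using Legendre_cong [of "int (n mod p)" "int n" "int p"] by (simp add: zmod_int cong_def)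
  show "\<exists>a. coprime a p \<and> real_of_int (Legendre (int a) (int p)) = -1"
    using ex_quadratic_nonresidue [OF p] by force
qed

text \<open>The nonprincipal Dirichlet character modulo 4; prescribing its value 1 forces a prime
  into the residue class 1.\<close>

definition character_4 :: "nat \<Rightarrow> real"
  where "character_4 n = (if even n then 0 else if n mod 4 = 1 then 1 else -1)"

lemma nonprincipal_real_character_4: "nonprincipal_real_character character_4 4"
proof
  show "character_4 (m * n) = character_4 m * character_4 n" for m n
  proof -
    have c: "character_4 k = (if k mod 4 = 1 then 1 else if k mod 4 = 3 then -1 else 0)" for k
    proof -
      have "odd k \<longleftrightarrow> k mod 4 = 1 \<or> k mod 4 = 3" by presburger
      then show ?thesis by (auto simp: character_4_def)
    qed
    have m4: "(m * n) mod 4 = ((m mod 4) * (n mod 4)) mod 4"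
      by (simp add: mod_mult_eq)
    have "k mod 4 \<in> {0, 1, 2, 3}" for k :: nat by auto
    from this [of m] this [of n] show ?thesis
      unfolding c m4 by (elim insertE emptyE) simp_all
  qed
  show "character_4 (n mod 4) = character_4 n" for n
    unfolding character_4_def by (simp add: dvd_mod_iff)
  show "\<exists>a. coprime a 4 \<and> character_4 a = - 1"
    by (rule exI [of _ 3]) (simp add: character_4_def coprime_iff_gcd_eq_1 gcd_nat.simps)
qed (auto simp: character_4_def)

lemma ex_prime_with_Legendre_symbols:
  fixes Y :: "nat set" and \<epsilon> :: "nat \<Rightarrow> int"
  assumes fin: "finite Y" and Y: "\<And>y. y \<in> Y \<Longrightarrow> prime y \<and> 2 < y"
    and \<epsilon>: "\<And>y. y \<in> Y \<Longrightarrow> \<epsilon> y \<in> {-1, 1}"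
  shows "\<exists>p. prime p \<and> [p = 1] (mod 4) \<and> (\<forall>y\<in>Y. Legendre (int p) (int y) = \<epsilon> y)"
proof -
  \<comment> \<open>The index 4 is free for \<open>character_4\<close>: all other moduli are
    primes.\<close>
  define \<psi> where "\<psi> w = (if w = 4 then character_4 else (\<lambda>n. real_of_int (Legendre (int n) (int w))))" for w
  have not4: "4 \<notin> Y"
  proof
    assume "4 \<in> Y"
    then have "prime (2 * 2 :: nat)" using Y by force
    then show False using prime_product by fastforce
  qed
  interpret independent_real_characters "insert 4 Y" \<psi>
  proof (rule independent_real_characters.intro)
    show "finite (insert 4 Y)" using fin by simp
    have odd: "coprime y 4" if "y \<in> Y" for y
    proof -
      have "odd y" using Y [OF that] prime_odd_nat by blast
      then show ?thesis using coprime_mult_right_iff [of y 2 2] by simp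
    qed
    show "coprime v w" if "v \<in> insert 4 Y" "w \<in> insert 4 Y" "v \<noteq> w" for v w
      using that odd odd [THEN coprime_commute [THEN iffD1]] Y [THEN conjunct1] primes_coprime [of v w] by auto
    show "nonprincipal_real_character (\<psi> w) w" if "w \<in> insert 4 Y" for w
      using that not4 Y nonprincipal_real_character_4 nonprincipal_real_character_Legendre
      by (auto simp: \<psi>_def)
    show "\<psi> w n \<noteq> 0" if w: "w \<in> insert 4 Y" and n: "coprime n w" for w n
    proof (cases "w = 4")
      case True
      then have "odd n" using n by (metis coprime_common_divisor dvd_triv_left mult_2 numeral_Bit0 odd_one)
      then show ?thesis using True by (simp add: \<psi>_def character_4_def)
    next
      case False
      then have "\<not> w dvd n" using w n Y by (metis coprime_absorb_right insertE not_prime_unit)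
      then have "\<not> [int n = 0] (mod int w)" by (simp add: cong_0_iff)
      then show ?thesis using False by (simp add: \<psi>_def Legendre_def)
    qed
  qed
  obtain p where p: "prime p" "\<forall>w\<in>insert 4 Y. \<psi> w p = (if w = 4 then 1 else real_of_int (\<epsilon> w))"
    using ex_prime_with_values [of "\<lambda>w. if w = 4 then 1 else real_of_int (\<epsilon> w)"] \<epsilon> by fastforce
  have "character_4 p = 1" using p(2) by (simp add: \<psi>_def)
  then have "[p = 1] (mod 4)"
    by (auto simp: character_4_def cong_def split: if_splits)
  moreover have "Legendre (int p) (int y) = \<epsilon> y" if "y \<in> Y" for y
  proof -
    have "y \<noteq> 4" using that not4 by blast
    then show ?thesis using bspec [OF p(2), of y] that by (simp add: \<psi>_def)
  qed
  ultimately show ?thesis using p(1) by blast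
qed

section \<open>Finite dimensional quantum automorphisms of the Rado graph\<close>

lemma rado_vertex_gt_2: "p \<in> rado_vertices \<Longrightarrow> prime p \<and> 2 < p"
proof -
  assume p: "p \<in> rado_vertices"
  then have "p \<noteq> 2" by (auto simp: rado_vertices_def cong_def)
  with p show ?thesis
    using prime_ge_2_nat [of p] by (auto simp: rado_vertices_def)
qed

text \<open>The extension property of the Rado graph. Prescribing the symbol of \<open>z\<close>
  modulo each \<open>y\<close> fixes the adjacency, and since the prescribed symbols are nonzero,
  \<open>z\<close> lies outside \<open>Y\<close>.\<close>

lemma rado_extension:
  assumes Y: "finite Y" "Y \<subseteq> rado_vertices"
  shows "\<exists>z\<in>rado_vertices. z \<notin> Y \<and> (\<forall>y\<in>Y. rado_adj y z \<longleftrightarrow> y \<in> S)"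
proof -
  have vertex: "prime y \<and> 2 < y" if "y \<in> Y" for y
    using rado_vertex_gt_2 Y that by blast
  have "(if y \<in> S then 1 else -1 :: int) \<in> {-1, 1}" for y
    by simp
  then have "\<exists>z. prime z \<and> [z = 1] (mod 4) \<and> (\<forall>y\<in>Y. Legendre (int z) (int y) = (if y \<in> S then 1 else -1))"
    by (intro ex_prime_with_Legendre_symbols [OF Y(1) vertex])
  then obtain z where z: "prime z" "[z = 1] (mod 4)"
    and leg: "\<forall>y\<in>Y. Legendre (int z) (int y) = (if y \<in> S then 1 else -1)"
    by blast
  have "z \<in> rado_vertices" using z by (simp add: rado_vertices_def)
  moreover have "z \<notin> Y"
  proof
    assume "z \<in> Y"
    moreover have "Legendre (int z) (int z) = 0"
      by (simp add: Legendre_def cong_0_iff)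
    ultimately show False using leg by (auto split: if_splits)
  qed
  moreover have "rado_adj y z \<longleftrightarrow> y \<in> S" if y: "y \<in> Y" for y
  proof -
    have "z \<noteq> y" using \<open>z \<notin> Y\<close> y by blast
    then have "rado_adj z y \<longleftrightarrow> QuadRes (int y) (int z)"
      by (simp add: rado_adj_def)
    also have "\<dots> \<longleftrightarrow> y \<in> S"
      using bspec [OF leg y] by (auto simp: Legendre_def split: if_splits)
    finally show ?thesis
      using rado_adj_sym [of z y] \<open>z \<in> rado_vertices\<close> Y y by blast
  qed
  ultimately show ?thesis by blast
qed

section \<open>Projections in finite dimension and generated algebras\<close>

lemma bounded_operator_simps:
  assumes "bounded_operator T"
  shows "T 0 = 0" "T (x + y) = T x + T y" "T (scaleC c x) = scaleC c (T x)"
    "T (sum f A) = (\<Sum>i\<in>A. T (f i))"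
proof -
  have "bounded_linear T" using assms by (simp add: bounded_operator_def)
  then have "linear T" by (rule bounded_linear.linear)
  then show "T 0 = 0" "T (x + y) = T x + T y" "T (sum f A) = (\<Sum>i\<in>A. T (f i))"
    by (simp_all add: linear_0 linear_add linear_sum)
  show "T (scaleC c x) = scaleC c (T x)"
    using assms by (simp add: bounded_operator_def)
qed

text \<open>Nonzero vectors chosen from the ranges of the nonzero projections are linearly
  independent: applying \<open>P x\<close> to a linear relation isolates the coefficient of the
  vector at \<open>x\<close>.\<close>

lemma finite_nonzero_partition:
  fixes P :: "'v \<Rightarrow> 'h::complex_hilbert_space \<Rightarrow> 'h"
  assumes fd: "finite_dimensional TYPE('h)" and P: "partition_of_unity V P"
  shows "finite {y \<in> V. P y \<noteq> (\<lambda>_. 0)}"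
proof -
  interpret vs: vector_space "scaleC :: complex \<Rightarrow> 'h \<Rightarrow> 'h"
    by (rule vector_space_scaleC)
  define N where "N = {y \<in> V. P y \<noteq> (\<lambda>_. 0)}"
  have "\<exists>v. P y v \<noteq> 0" if "y \<in> N" for y
    using that by (auto simp: N_def fun_eq_iff)
  then obtain v where v: "\<And>y. y \<in> N \<Longrightarrow> P y (v y) \<noteq> 0"
    by metis
  define e where "e y = P y (v y)" for y
  have bo: "bounded_operator (P y)" if "y \<in> N" for y
    using that P by (auto simp: N_def partition_of_unity_def projection_def)
  have Pe: "P x (e y) = (if x = y then e y else 0)" if "x \<in> N" "y \<in> N" for x y
    using that P by (auto simp: N_def e_def partition_of_unity_def projection_def fun_eq_iff)
  have e0: "e y \<noteq> 0" if "y \<in> N" for y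
    using v that by (simp add: e_def)
  have inj: "inj_on e N"
    using Pe e0 by (metis inj_onI)
  have "vs.independent (e ` N)"
    unfolding vs.independent_explicit_finite_subsets
  proof (intro allI impI ballI)
    fix A c a
    assume A: "A \<subseteq> e ` N" "finite A" and sum0: "(\<Sum>v\<in>A. scaleC (c v) v) = 0" and a: "a \<in> A"
    obtain x where x: "x \<in> N" "a = e x" using A a by blast
    have Pv: "P x w = (if w = a then a else 0)" if w: "w \<in> A" for w
    proof -
      obtain y where y: "y \<in> N" "w = e y" using A w by blast
      then show ?thesis using Pe [OF x(1) y(1)] x inj by (auto dest: inj_onD)
    qed
    have "0 = P x (\<Sum>v\<in>A. scaleC (c v) v)"
      using bounded_operator_simps(1) [OF bo [OF x(1)]] sum0 by simp
    also have "\<dots> = (\<Sum>v\<in>A. scaleC (c v) (P x v))"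
      by (simp add: bounded_operator_simps(3,4) [OF bo [OF x(1)]])
    also have "\<dots> = (\<Sum>v\<in>A. if v = a then scaleC (c a) a else 0)"
      using Pv by (intro sum.cong) auto
    also have "\<dots> = scaleC (c a) a"
      using A a by simp
    finally show "c a = 0"
      using e0 [OF x(1)] x(2) by simp
  qed
  moreover obtain B :: "'h set" where "finite B" "vs.span B = UNIV"
    using fd by (auto simp: finite_dimensional_def)
  ultimately have "finite (e ` N)"
    using vs.independent_span_bound [of B "e ` N"] by simp
  then show ?thesis
    using finite_image_iff [OF inj] by (simp add: N_def)
qed

lemma has_sum_finite_support:
  fixes f :: "'v \<Rightarrow> 'a::{topological_comm_monoid_add,t2_space}"
  assumes f: "(f has_sum s) V" and Y: "finite Y" "Y \<subseteq> V" "\<And>y. y \<in> V - Y \<Longrightarrow> f y = 0"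
  shows "sum f Y = s"
proof -
  have "(f has_sum s) Y"
    using has_sum_cong_neutral [of Y V f f s] f Y by blast
  then show ?thesis
    by (rule has_sum_unique [OF has_sum_finite [OF Y(1)]])
qed

lemma generated_algebra_bounded_operator:
  fixes G :: "('h::complex_hilbert_space \<Rightarrow> 'h) set"
  assumes G: "\<And>T. T \<in> G \<Longrightarrow> bounded_operator T" and T: "T \<in> generated_algebra G"
  shows "T (x + y) = T x + T y \<and> T 0 = 0 \<and> T (scaleC c x) = scaleC c (T x)"
  using T
proof (induction arbitrary: x y c)
  case (scale T d)
  interpret vs: vector_space "scaleC :: complex \<Rightarrow> 'h \<Rightarrow> 'h"
    by (rule vector_space_scaleC)
  show ?case using scale by (simp add: scaleC_add_right scaleC_scaleC mult.commute)
next
  case zero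
  interpret vs: vector_space "scaleC :: complex \<Rightarrow> 'h \<Rightarrow> 'h"
    by (rule vector_space_scaleC)
  show ?case by simp
qed (auto simp: bounded_operator_simps [OF G] scaleC_add_right add_ac)

text \<open>Two inductions: first a generator is moved past an arbitrary element \<open>B\<close>,
  then \<open>T\<close> is kept fixed while \<open>S\<close> varies. Linearity handles sums and
  scalars.\<close>

lemma generated_algebra_commute:
  fixes G :: "('h::complex_hilbert_space \<Rightarrow> 'h) set"
  assumes G: "\<And>T. T \<in> G \<Longrightarrow> bounded_operator T"
    and comm: "\<And>S T x. S \<in> G \<Longrightarrow> T \<in> G \<Longrightarrow> S (T x) = T (S x)"
    and S: "S \<in> generated_algebra G" and T: "T \<in> generated_algebra G"
  shows "S (T x) = T (S x)"
proof -
  have gen: "A (B x) = B (A x)" if A: "A \<in> G" and B: "B \<in> generated_algebra G" for A B x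
    using B
  proof (induction arbitrary: x)
    case (generator T)
    then show ?case using comm A by simp
  qed (simp_all add: bounded_operator_simps [OF G [OF A]])
  show ?thesis
    using S
  proof (induction arbitrary: x)
    case (generator S)
    then show ?case by (rule gen [OF _ T])
  qed (simp_all add: generated_algebra_bounded_operator [OF G T])
qed

section \<open>Commutation of the entries\<close>

locale finite_quantum_automorphism =
  fixes u :: "nat \<Rightarrow> nat \<Rightarrow> 'h::complex_hilbert_space \<Rightarrow> 'h"
  assumes fd: "finite_dimensional TYPE('h)"
    and qa: "quantum_automorphism rado_vertices rado_adj u"
begin

abbreviation "V \<equiv> rado_vertices"

lemma row: "x \<in> V \<Longrightarrow> partition_of_unity V (u x)"
  and column: "y \<in> V \<Longrightarrow> partition_of_unity V (\<lambda>x. u x y)"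
  using qa by (auto simp: quantum_automorphism_def)

lemma rel_zero:
  assumes "x1 \<in> V" "y1 \<in> V" "x2 \<in> V" "y2 \<in> V" "rel rado_adj x1 x2 \<noteq> rel rado_adj y1 y2"
  shows "u x1 y1 (u x2 y2 \<xi>) = 0"
  using qa assms unfolding quantum_automorphism_def by (metis comp_apply)

lemma projection: "x \<in> V \<Longrightarrow> y \<in> V \<Longrightarrow> projection (u x y)"
  using row by (simp add: partition_of_unity_def)

lemma operator: "x \<in> V \<Longrightarrow> y \<in> V \<Longrightarrow> bounded_operator (u x y)"
  using projection projection_def by blast

lemma idem: "x \<in> V \<Longrightarrow> y \<in> V \<Longrightarrow> u x y (u x y \<xi>) = u x y \<xi>"
  using projection unfolding projection_def by (metis comp_apply)

definition support :: "nat \<Rightarrow> nat set"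
  where "support x = {y \<in> V. u x y \<noteq> (\<lambda>_. 0)}"

lemma finite_support: "x \<in> V \<Longrightarrow> finite (support x)"
  unfolding support_def by (rule finite_nonzero_partition [OF fd row])

lemma sum_row:
  assumes x: "x \<in> V" and Y: "finite Y" "Y \<subseteq> V" "support x \<subseteq> Y"
  shows "(\<Sum>y\<in>Y. u x y \<xi>) = \<xi>"
proof (rule has_sum_finite_support [where V = V])
  show "((\<lambda>y. u x y \<xi>) has_sum \<xi>) V"
    using row [OF x] by (simp add: partition_of_unity_def)
  show "u x y \<xi> = 0" if "y \<in> V - Y" for y
    using that Y(3) by (auto simp: support_def fun_eq_iff)
qed (use Y in auto)

text \<open>
  The vertex \<open>z\<close> separates \<open>S\<close> from the rest of \<open>Y\<close>, so that the partial row sum over \<open>S\<close> acts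
  on the range of each \<open>u x z\<close> as a scalar.
\<close>

lemma partial_row_sum_scalar:
  assumes x: "x \<in> V" "x' \<in> V" and Y: "finite Y" "Y \<subseteq> V" "support x' \<subseteq> Y" and S: "S \<subseteq> Y"
    and z: "z \<in> V" "z \<notin> Y" "\<And>y. y \<in> Y \<Longrightarrow> rado_adj y z \<longleftrightarrow> y \<in> S"
  shows "(\<Sum>y\<in>S. u x' y (u x z \<xi>)) = (if rel rado_adj x' x = Adjacent then u x z \<xi> else 0)"
proof (cases "rel rado_adj x' x = Adjacent")
  case True
  have "(\<Sum>y\<in>S. u x' y (u x z \<xi>)) = (\<Sum>y\<in>Y. u x' y (u x z \<xi>))"
  proof (rule sum.mono_neutral_left [OF Y(1) S], rule ballI)
    fix y assume y: "y \<in> Y - S"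
    then have "rel rado_adj y z = Nonadjacent"
      using z by (auto simp: rel_def)
    then show "u x' y (u x z \<xi>) = 0"
      using True x y Y(2) z(1) by (intro rel_zero) auto
  qed
  also have "\<dots> = u x z \<xi>"
    by (rule sum_row [OF x(2) Y])
  finally show ?thesis using True by simp
next
  case False
  have "(\<Sum>y\<in>S. u x' y (u x z \<xi>)) = 0"
  proof (rule sum.neutral, rule ballI)
    fix y assume y: "y \<in> S"
    then have "rel rado_adj y z = Adjacent"
      using z S by (auto simp: rel_def)
    then show "u x' y (u x z \<xi>) = 0"
      using False x y Y(2) S z(1) by (intro rel_zero) auto
  qed
  then show ?thesis using False by simp
qed

text \<open>On the range of each \<open>u x z\<close> both partial sums act as the scalar 0 or 1, so
  they commute there, and the column of \<open>z\<close> sums to the identity.\<close>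

lemma partial_row_sums_commute:
  assumes x: "x1 \<in> V" "x2 \<in> V" and S: "finite S" "S \<subseteq> V"
  shows "(\<Sum>y\<in>S. u x1 y (\<Sum>y'\<in>S. u x2 y' \<xi>)) = (\<Sum>y\<in>S. u x2 y (\<Sum>y'\<in>S. u x1 y' \<xi>))"
proof -
  define Y where "Y = S \<union> support x1 \<union> support x2"
  have Y: "finite Y" "Y \<subseteq> V" "support x1 \<subseteq> Y" "support x2 \<subseteq> Y" "S \<subseteq> Y"
    using S finite_support x by (auto simp: Y_def support_def)
  obtain z where z: "z \<in> V" "z \<notin> Y" "\<And>y. y \<in> Y \<Longrightarrow> rado_adj y z \<longleftrightarrow> y \<in> S"
    using rado_extension [OF Y(1,2), of S] by blast
  define p where "p x \<eta> = (\<Sum>y\<in>S. u x y \<eta>)" for x \<eta>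
  have bl: "bounded_linear (p x)" if "x \<in> V" for x
  proof -
    have "bounded_linear (u x y)" if "y \<in> S" for y
      using operator [of x y] S \<open>x \<in> V\<close> that by (auto simp: bounded_operator_def)
    then show ?thesis unfolding p_def by (rule bounded_linear_sum)
  qed
  have p_scalar: "p x' (u x z \<xi>) = (if rel rado_adj x' x = Adjacent then u x z \<xi> else 0)"
    if "x' \<in> {x1, x2}" "x \<in> V" for x x'
    unfolding p_def using that x Y z by (intro partial_row_sum_scalar [of _ _ Y]) auto
  have p_zero: "p x 0 = 0" if "x \<in> V" for x
    using bl [OF that] by (simp add: linear_0 bounded_linear.linear)
  \<comment> \<open>The column sum is over all of \<open>V\<close>; boundedness of the partial row
    sums allows applying them term by term.\<close>
  have sum: "((\<lambda>x. p a (p b (u x z \<xi>))) has_sum p a (p b \<xi>)) V" if "a \<in> V" "b \<in> V" for a b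
  proof -
    have "((\<lambda>x. u x z \<xi>) has_sum \<xi>) V"
      using column [OF z(1)] by (simp add: partition_of_unity_def)
    from has_sum_bounded_linear [OF bl [OF that(2)] this]
    have "((\<lambda>x. p b (u x z \<xi>)) has_sum p b \<xi>) V" by (simp add: comp_def)
    from has_sum_bounded_linear [OF bl [OF that(1)] this]
    show ?thesis by (simp add: comp_def)
  qed
  have "p x1 (p x2 (u x z \<xi>)) = p x2 (p x1 (u x z \<xi>))" if "x \<in> V" for x
    using p_scalar [OF _ that] p_zero x by simp
  then have "((\<lambda>x. p x1 (p x2 (u x z \<xi>))) has_sum p x2 (p x1 \<xi>)) V"
    using sum [OF x(2,1)] by (simp cong: has_sum_cong)
  then have "p x1 (p x2 \<xi>) = p x2 (p x1 \<xi>)"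
    by (rule has_sum_unique [OF sum [OF x]])
  then show ?thesis by (simp add: p_def)
qed

lemma entries_commute:
  assumes V: "x1 \<in> V" "y1 \<in> V" "x2 \<in> V" "y2 \<in> V"
  shows "u x1 y1 (u x2 y2 \<xi>) = u x2 y2 (u x1 y1 \<xi>)"
proof -
  have same_row: "u x y (u x y' \<xi>) = 0" if "x \<in> V" "y \<in> V" "y' \<in> V" "y \<noteq> y'" for x y y' \<xi>
    using that by (intro rel_zero) (auto simp: rel_def)
  have same_column: "u x y (u x' y \<xi>) = 0" if "x \<in> V" "x' \<in> V" "y \<in> V" "x \<noteq> x'" for x x' y \<xi>
    using that by (intro rel_zero) (auto simp: rel_def)
  show ?thesis
  proof (cases "x1 = x2 \<or> y1 = y2")
    case True
    then show ?thesis using V same_row same_column by (metis (full_types))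
  next
    case False
    let ?a = "u x1 y1" and ?a' = "u x1 y2" and ?b = "u x2 y1" and ?b' = "u x2 y2"
    note op = operator [OF V(1,2)] operator [OF V(1,4)] operator [OF V(3,2)] operator [OF V(3,4)]
    note lin = op [THEN bounded_operator_simps(2)] op [THEN bounded_operator_simps(1)]
    have zero: "?a (?b \<eta>) = 0" "?b (?a \<eta>) = 0" "?a' (?b' \<eta>) = 0" "?b' (?a' \<eta>) = 0"
      "?a (?a' \<eta>) = 0" "?a' (?a \<eta>) = 0" for \<eta>
      using V False same_row same_column by auto
    have comm: "?a (?b' \<eta>) + ?a' (?b \<eta>) = ?b (?a' \<eta>) + ?b' (?a \<eta>)" for \<eta>
      using partial_row_sums_commute [OF V(1,3), of "{y1, y2}" \<eta>] V False
      by (simp add: lin zero)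
    \<comment> \<open>Multiplication by \<open>?a\<close> on the left kills the two mixed terms,
      because \<open>?a\<close> is orthogonal to \<open>?a'\<close> and \<open>?b\<close>.\<close>
    have "?a (?a (?b' \<xi>) + ?a' (?b \<xi>)) = ?a (?b (?a' \<xi>) + ?b' (?a \<xi>))"
      by (simp only: comm)
    then have "?a (?b' \<xi>) = ?a (?b' (?a \<xi>))"
      by (simp add: lin zero idem V)
    \<comment> \<open>Multiplication by \<open>?a\<close> on the right kills the mixed terms in the
      same way.\<close>
    moreover have "?a (?b' (?a \<xi>)) = ?b' (?a \<xi>)"
      using comm [of "?a \<xi>"] by (simp add: lin zero idem V)
    ultimately show ?thesis by simp
  qed
qed

lemma classical: "classical V u"
  unfolding classical_def
proof (intro ballI ext)
  let ?G = "{u x y | x y. x \<in> V \<and> y \<in> V}"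
  fix S T \<xi>
  assume "S \<in> generated_algebra ?G" "T \<in> generated_algebra ?G"
  moreover have "bounded_operator A" if "A \<in> ?G" for A
    using that operator by blast
  moreover have "A (B \<eta>) = B (A \<eta>)" if "A \<in> ?G" "B \<in> ?G" for A B \<eta>
    using that entries_commute by blast
  ultimately show "(S \<circ> T) \<xi> = (T \<circ> S) \<xi>"
    using generated_algebra_commute [of ?G S T \<xi>] by simp
qed

end

theorem proposition7p15:
  shows "\<not> (\<exists>u :: nat \<Rightarrow> nat \<Rightarrow> 'h::complex_hilbert_space \<Rightarrow> 'h.
    finite_dimensional TYPE('h) \<and>
    quantum_automorphism rado_vertices rado_adj u \<and>
    \<not> classical rado_vertices u)"
  using finite_quantum_automorphism.classical by (auto simp: finite_quantum_automorphism_def)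

end
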